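(* For all $n \geq 9$, \[\text{ex}_o(n,I_0) = \begin{cases} n(n-3) + \frac{n}{3} & n \equiv 0 \pmod 3,\\ n(n-3) + \frac{n-4}{3} & n \equiv 1 \pmod 3, \\ n(n-3) + \frac{n-5}{3} & n \equiv 2 \pmod 3.\end{cases}\] Moreover, up to isomorphism, the number of $I_0$-free oriented $(2\to1)$-graphs on $n$ vertices with exactly $\text{ex}_o(n,I_0)$ edges is exactly $1$ when $n\equiv 0 \pmod 3$, exactly $18$ when $n \equiv 1 \pmod 3$, and exactly $32$ when $n \equiv 2 \pmod 3$.
   Context: A $(2\to 1)$-graph (directed hypergraph) is a pair $H=(V,E)$ with $V$ a finite set and $E$ a set of pointed $3$-subsets of $V$: an edge, written $ab\to c$ (same as $ba\to c$), consists of three distinct vertices with head $c$ and tail set $\{a,b\}$. $H$ is oriented if every $3$-subset of $V$ carries at most one edge (in general it may carry up to three). $H$ is $F$-free if there is no injective map $\phi:V(F)\to V(H)$ such that $ab\to c\in E(F)$ implies $\phi(a)\phi(b)\to\phi(c)\in E(H)$. $\text{ex}_o(n,F)$ is the maximum number of edges of an $F$-free oriented $(2\to1)$-graph on $n$ vertices. $I_0$ is the $(2\to1)$-graph with vertex set $\{a,b,c,d,x\}$ (five distinct vertices) and edges $ab\to x$, $cd\to x$. Isomorphism means a bijection of vertex sets that preserves edges in both directions. *)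

theory Defs
  imports Complex_Main
begin

text \<open>
  The edge \<open>ab \<rightarrow> c\<close> is encoded as the pair \<open>({a, b}, c)\<close> of its tail set and its head.
\<close>

datatype 'a pre_hgraph = HGraph (verts: "'a set") (edges: "('a set \<times> 'a) set")

definition hgraph :: "'a pre_hgraph \<Rightarrow> bool" where
  "hgraph H \<longleftrightarrow> finite (verts H) \<and>
     (\<forall>(T, h) \<in> edges H. T \<subseteq> verts H \<and> card T = 2 \<and> h \<in> verts H \<and> h \<notin> T)"

definition oriented :: "'a pre_hgraph \<Rightarrow> bool" where
  "oriented H \<longleftrightarrow>
     (\<forall>S. S \<subseteq> verts H \<and> card S = 3 \<longrightarrow> card {(T, h) \<in> edges H. insert h T = S} \<le> 1)"

definition hfree :: "'b pre_hgraph \<Rightarrow> 'a pre_hgraph \<Rightarrow> bool" where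
  "hfree F H \<longleftrightarrow> \<not> (\<exists>\<phi>. inj_on \<phi> (verts F) \<and> \<phi> ` verts F \<subseteq> verts H \<and>
     (\<forall>(T, h) \<in> edges F. (\<phi> ` T, \<phi> h) \<in> edges H))"

definition hiso :: "'a pre_hgraph \<Rightarrow> 'b pre_hgraph \<Rightarrow> bool" where
  "hiso G H \<longleftrightarrow> (\<exists>\<phi>. bij_betw \<phi> (verts G) (verts H) \<and>
     (\<forall>T h. T \<subseteq> verts G \<and> h \<in> verts G \<longrightarrow>
        ((T, h) \<in> edges G \<longleftrightarrow> (\<phi> ` T, \<phi> h) \<in> edges H)))"

text \<open>
  Vertices are drawn from \<open>nat\<close>, which loses nothing up to isomorphism. There are infinitely
  many graphs on \<open>n\<close> vertices in \<open>nat\<close>, but only finitely many edge counts and finitely many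
  isomorphism classes, so \<open>Max\<close> and \<open>card\<close> below are applied to finite sets.
\<close>

definition free_oriented :: "nat \<Rightarrow> 'b pre_hgraph \<Rightarrow> nat pre_hgraph set" where
  "free_oriented n F = {H. hgraph H \<and> card (verts H) = n \<and> oriented H \<and> hfree F H}"

definition ex_o :: "nat \<Rightarrow> 'b pre_hgraph \<Rightarrow> nat" where
  "ex_o n F = Max {card (edges H) | H. H \<in> free_oriented n F}"

definition extremal :: "nat \<Rightarrow> 'b pre_hgraph \<Rightarrow> nat pre_hgraph set" where
  "extremal n F = {H \<in> free_oriented n F. card (edges H) = ex_o n F}"

definition num_iso_classes :: "'a pre_hgraph set \<Rightarrow> nat" where
  "num_iso_classes X = card (X // {(G, H). G \<in> X \<and> H \<in> X \<and> hiso G H})"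

definition I0 :: "nat pre_hgraph" where
  "I0 = HGraph {0, 1, 2, 3, 4} {({0, 1}, 4), ({2, 3}, 4)}"

lemma hiso_refl: "hiso G G"
  unfolding hiso_def by (rule exI[of _ id]) auto

lemma hiso_sym:
  assumes "hiso G H" shows "hiso H G"
proof -
  obtain f where f: "bij_betw f (verts G) (verts H)"
    and e: "\<And>T h. T \<subseteq> verts G \<Longrightarrow> h \<in> verts G \<Longrightarrow>
          ((T, h) \<in> edges G \<longleftrightarrow> (f ` T, f h) \<in> edges H)"
    using assms unfolding hiso_def by blast
  define g where "g = inv_into (verts G) f"
  have g: "bij_betw g (verts H) (verts G)"
    unfolding g_def by (rule bij_betw_inv_into[OF f])
  have fg: "f (g y) = y" if "y \<in> verts H" for y
    using f that unfolding g_def by (simp add: bij_betw_inv_into_right)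
  have "((T, h) \<in> edges H) = ((g ` T, g h) \<in> edges G)" if "T \<subseteq> verts H" "h \<in> verts H" for T h
  proof -
    have "f ` g ` T = T" using fg that(1) by (force simp: image_image)
    moreover have "g ` T \<subseteq> verts G" "g h \<in> verts G"
      using g that by (auto simp: bij_betw_def)
    ultimately show ?thesis using e[of "g ` T" "g h"] fg[OF that(2)] by simp
  qed
  then show ?thesis unfolding hiso_def using g by blast
qed

lemma hiso_trans:
  assumes "hiso G H" "hiso H K" shows "hiso G K"
proof -
  obtain f where f: "bij_betw f (verts G) (verts H)"
    and e: "\<And>T h. T \<subseteq> verts G \<Longrightarrow> h \<in> verts G \<Longrightarrow>
          ((T, h) \<in> edges G \<longleftrightarrow> (f ` T, f h) \<in> edges H)"
    using assms(1) unfolding hiso_def by blast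
  obtain g where g: "bij_betw g (verts H) (verts K)"
    and e': "\<And>T h. T \<subseteq> verts H \<Longrightarrow> h \<in> verts H \<Longrightarrow>
          ((T, h) \<in> edges H \<longleftrightarrow> (g ` T, g h) \<in> edges K)"
    using assms(2) unfolding hiso_def by blast
  have "((T, h) \<in> edges G) = (((g \<circ> f) ` T, (g \<circ> f) h) \<in> edges K)"
    if "T \<subseteq> verts G" "h \<in> verts G" for T h
  proof -
    have "f ` T \<subseteq> verts H" "f h \<in> verts H" using f that by (auto simp: bij_betw_def)
    then show ?thesis using e[OF that] e'[of "f ` T" "f h"] by (simp add: image_comp)
  qed
  then show ?thesis unfolding hiso_def using bij_betw_trans[OF f g] by blast
qed

lemma equiv_hiso: "equiv X {(G, H). G \<in> X \<and> H \<in> X \<and> hiso G H}"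
  by (rule equivI) (auto simp: refl_on_def sym_def trans_def
      intro: hiso_refl hiso_sym hiso_trans)

end

theory Submission
  imports Defs
begin

text \<open>
  In an \<open>I\<^sub>0\<close>-free graph the tails of the edges with a given head \<open>x\<close> meet pairwise, so they form a
  star with some centre \<open>f x\<close>, or else there are at most three of them. Vertices without a centre and
  two-cycles of \<open>f\<close> cost too many edges once \<open>n \<ge> 9\<close>. Otherwise each of the \<open>n (n - 2)\<close> slots \<open>{f x, z} \<rightarrow> x\<close>
  is filled or not, and orientedness leaves one slot empty on each triple \<open>x, f x, f (f x)\<close> and on
  each triple \<open>x, y, f x = f y\<close>; a three-cycle of \<open>f\<close> saves one slot, as it gives three times the same triple
  and only two empty slots. Hence \<open>f\<close> splits into as many three-cycles as possible and, for \<open>n\<close>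
  not divisible by 3, a core of 4 or 5 vertices: either one cycle, or a path of 1 or 2 vertices running into a
  three-cycle. The extremal graphs correspond to the free choices of heads in the core:
  binary necklaces (6 or 8) for the cycle, and \<open>3 * 2 * 2 = 12\<close> or \<open>3 * 2 * 2 * 2 = 24\<close> rigid choices for the path.
\<close>

text \<open>When every slot that orientedness permits is filled, the number of edges is
  \<open>n (n - 2) - n + p - l\<close>, where \<open>p\<close> counts the three-cycles of
  \<open>f\<close> whose triple has a head and \<open>l\<close> the slots lost to collisions
  \<open>f x = f y\<close>. So only \<open>p - l\<close> matters, and \<open>p\<close> is at most
  \<open>n div 3\<close>. If 3 does not divide \<open>n\<close>, then \<open>p = n div 3\<close> and
  \<open>l = 0\<close> exclude each other: \<open>f\<close> would permute one or two leftover
  vertices without a fixed point or a two-cycle. One unit must be given up, either as a missing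
  three-cycle (then \<open>f\<close> is a permutation with one cycle of length 4 or 5) or as a
  single collision (a path running into a three-cycle). These are the two families whose sizes add
  up to \<open>6 + 12\<close> and \<open>8 + 24\<close>. The classification also needs
  \<open>f\<close> to be visible in the bare graph. In the normal forms every vertex heads at least
  two edges, so \<open>f x\<close> is the common point of the tails at \<open>x\<close>, and
  isomorphisms of graphs become conjugacies of the maps.\<close>

section \<open>Orientedness and freeness as conditions on pairs of edges\<close>

text \<open>On a fixed triple the head determines the tail as its complement, so two edges on it
  coincide as soon as their heads do.\<close>

lemma oriented_iff:
  assumes "hgraph H"
  shows "oriented H \<longleftrightarrow>
    (\<forall>T h T' h'. (T, h) \<in> edges H \<longrightarrow> (T', h') \<in> edges H \<longrightarrow> insert h T = insert h' T' \<longrightarrow> h = h')"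
proof
  assume o: "oriented H"
  show "\<forall>T h T' h'. (T, h) \<in> edges H \<longrightarrow> (T', h') \<in> edges H \<longrightarrow> insert h T = insert h' T' \<longrightarrow> h = h'"
  proof (intro allI impI)
    fix T h T' h' assume e: "(T, h) \<in> edges H" "(T', h') \<in> edges H" "insert h T = insert h' T'"
    let ?X = "{(U, g) \<in> edges H. insert g U = insert h T}"
    have T: "T \<subseteq> verts H" "card T = 2" "h \<in> verts H" "h \<notin> T" "finite (verts H)"
      using assms e(1) unfolding hgraph_def by auto
    have "edges H \<subseteq> Pow (verts H) \<times> verts H" using assms unfolding hgraph_def by auto
    then have "finite (edges H)" using T(5) by (meson finite_Pow_iff finite_SigmaI finite_subset)
    then have fin: "finite ?X" by (rule rev_finite_subset) auto
    have "card (insert h T) = 3" using T card_ge_0_finite[of T] by simp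
    then have "card ?X \<le> 1" using o T unfolding oriented_def by auto
    moreover have "(T, h) \<in> ?X" "(T', h') \<in> ?X" using e by auto
    ultimately have "(T, h) = (T', h')" using fin card_le_Suc0_iff_eq[OF fin] by auto
    then show "h = h'" by simp
  qed
next
  assume e: "\<forall>T h T' h'. (T, h) \<in> edges H \<longrightarrow> (T', h') \<in> edges H \<longrightarrow> insert h T = insert h' T' \<longrightarrow> h = h'"
  show "oriented H" unfolding oriented_def
  proof (intro allI impI)
    fix S assume "S \<subseteq> verts H \<and> card S = 3"
    let ?X = "{(U, g) \<in> edges H. insert g U = S}"
    have "p = q" if "p \<in> ?X" "q \<in> ?X" for p q
    proof -
      obtain T h T' h' where pq: "p = (T, h)" "q = (T', h')" by (cases p, cases q)
      have h: "h = h'" using e that unfolding pq by blast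
      have "h \<notin> T" "h' \<notin> T'" using that assms unfolding pq hgraph_def by auto
      then have "T = T'" using that h unfolding pq by auto
      with h show ?thesis by (simp add: pq)
    qed
    then show "card ?X \<le> 1"
      by (cases "finite ?X") (auto simp: card_le_Suc0_iff_eq)
  qed
qed

text \<open>Tails have two elements and avoid the head, so two disjoint tails with a common head
  already give five distinct vertices, that is, a copy of \<open>I0\<close>.\<close>

lemma hfree_I0_iff:
  assumes "hgraph H"
  shows "hfree I0 H \<longleftrightarrow> (\<forall>S T h. (S, h) \<in> edges H \<longrightarrow> (T, h) \<in> edges H \<longrightarrow> S \<inter> T \<noteq> {})"
proof
  assume fr: "hfree I0 H"
  show "\<forall>S T h. (S, h) \<in> edges H \<longrightarrow> (T, h) \<in> edges H \<longrightarrow> S \<inter> T \<noteq> {}"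
  proof (intro allI impI notI)
    fix S T h assume e: "(S, h) \<in> edges H" "(T, h) \<in> edges H" "S \<inter> T = {}"
    have p: "S \<subseteq> verts H" "card S = 2" "h \<in> verts H" "h \<notin> S" "T \<subseteq> verts H" "card T = 2" "h \<notin> T"
      using assms e unfolding hgraph_def by auto
    obtain a b c d where ab: "S = {a, b}" "a \<noteq> b" "T = {c, d}" "c \<noteq> d"
      using p(2,6) by (auto simp: card_2_iff)
    define \<phi> :: "nat \<Rightarrow> 'a" where "\<phi> = (\<lambda>i. if i = 0 then a else if i = 1 then b else if i = 2 then c else if i = 3 then d else h)"
    have "inj_on \<phi> {0,1,2,3,4}" using ab p e(3) by (auto simp: inj_on_def \<phi>_def)
    moreover have "\<phi> ` {0,1,2,3,4} \<subseteq> verts H" using p ab by (auto simp: \<phi>_def)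
    moreover have "(\<phi> ` {0,1}, \<phi> 4) \<in> edges H" "(\<phi> ` {2,3}, \<phi> 4) \<in> edges H"
      using e ab by (simp_all add: \<phi>_def insert_commute)
    ultimately show False using fr unfolding hfree_def I0_def by auto
  qed
next
  assume e: "\<forall>S T h. (S, h) \<in> edges H \<longrightarrow> (T, h) \<in> edges H \<longrightarrow> S \<inter> T \<noteq> {}"
  show "hfree I0 H" unfolding hfree_def
  proof
    assume "\<exists>\<phi>. inj_on \<phi> (verts I0) \<and> \<phi> ` verts I0 \<subseteq> verts H \<and> (\<forall>(T, h)\<in>edges I0. (\<phi> ` T, \<phi> h) \<in> edges H)"
    then obtain \<phi> :: "nat \<Rightarrow> 'a" where inj: "inj_on \<phi> (verts I0)"
      and \<phi>: "\<forall>(T, h)\<in>edges I0. (\<phi> ` T, \<phi> h) \<in> edges H" by blast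
    have "\<phi> ` {0, 1} \<inter> \<phi> ` {2, 3} = {}"
      using inj_on_image_Int[OF inj, of "{0, 1}" "{2, 3}"] by (simp add: I0_def)
    moreover have "(\<phi> ` {0, 1}, \<phi> 4) \<in> edges H" "(\<phi> ` {2, 3}, \<phi> 4) \<in> edges H"
      using \<phi> by (auto simp: I0_def)
    ultimately show False using e by blast
  qed
qed

section \<open>Graphs built from a map \<open>f\<close>, and their number of edges\<close>

text \<open>
  \<open>A\<close> says which \<open>x\<close> head the triple \<open>x, f x, f (f x)\<close>; \<open>(x, z) \<in> B\<close> says that \<open>x\<close> heads the triple
  \<open>x, z, f x = f z\<close>.
\<close>

definition star_edges :: "'a set \<Rightarrow> ('a \<Rightarrow> 'a) \<Rightarrow> 'a set \<Rightarrow> ('a \<times> 'a) set \<Rightarrow> ('a set \<times> 'a) set" where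
  "star_edges V f A B = (\<lambda>(x, z). ({f x, z}, x)) `
     {(x, z). x \<in> V \<and> z \<in> V \<and> z \<noteq> x \<and> z \<noteq> f x \<and>
        (z = f (f x) \<longrightarrow> x \<in> A) \<and> (f z = x \<longrightarrow> z \<notin> A) \<and> (f z = f x \<longrightarrow> (x, z) \<in> B)}"

text \<open>The last two assumptions are what orientedness demands of \<open>A\<close> and
  \<open>B\<close>. The vertices of a three-cycle share one triple, so at most one of them may be in
  \<open>A\<close>; two vertices with the same image compete for the triple they form with
  it.\<close>

locale star_frame =
  fixes V :: "'a set" and f :: "'a \<Rightarrow> 'a" and A :: "'a set" and B :: "('a \<times> 'a) set"
  assumes fin: "finite V"
    and closed: "x \<in> V \<Longrightarrow> f x \<in> V"
    and no_fix: "x \<in> V \<Longrightarrow> f x \<noteq> x"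
    and no_2cycle: "x \<in> V \<Longrightarrow> f (f x) \<noteq> x"
    and A_cycle: "x \<in> V \<Longrightarrow> f (f (f x)) = x \<Longrightarrow> x \<in> A \<Longrightarrow> f x \<notin> A"
    and B_antisym: "x \<in> V \<Longrightarrow> y \<in> V \<Longrightarrow> x \<noteq> y \<Longrightarrow> f x = f y \<Longrightarrow> (x, y) \<in> B \<Longrightarrow> (y, x) \<notin> B"
begin

abbreviation "H \<equiv> HGraph V (star_edges V f A B)"

lemma star_edges_iff:
  assumes "x \<in> V" "z \<in> V" "z \<noteq> x" "z \<noteq> f x"
  shows "({f x, z}, x) \<in> star_edges V f A B \<longleftrightarrow>
    (z = f (f x) \<longrightarrow> x \<in> A) \<and> (f z = x \<longrightarrow> z \<notin> A) \<and> (f z = f x \<longrightarrow> (x, z) \<in> B)"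
  using assms unfolding star_edges_def by (auto simp: doubleton_eq_iff)

lemma star_edgesE:
  assumes "(T, x) \<in> star_edges V f A B"
  obtains z where "T = {f x, z}" "x \<in> V" "z \<in> V" "z \<noteq> x" "z \<noteq> f x"
    "z = f (f x) \<Longrightarrow> x \<in> A" "f z = x \<Longrightarrow> z \<notin> A" "f z = f x \<Longrightarrow> (x, z) \<in> B"
  using assms unfolding star_edges_def by auto

lemma hgraph: "hgraph H"
  unfolding hgraph_def
proof (simp add: fin, clarify)
  fix T h assume "(T, h) \<in> star_edges V f A B"
  then obtain z where "T = {f h, z}" "h \<in> V" "z \<in> V" "z \<noteq> h" "z \<noteq> f h"
    by (rule star_edgesE)
  then show "T \<subseteq> V \<and> card T = 2 \<and> h \<in> V \<and> h \<notin> T"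
    using closed[of h] no_fix[of h] by auto
qed

text \<open>Two heads of one triple are either \<open>h\<close> and \<open>f h\<close>, where the
  first edge needs \<open>h \<in> A\<close> and the second \<open>h \<notin> A\<close>, or each is
  the free end of the other's tail. Then they have the same image, and \<open>B_antisym\<close>
  applies.\<close>

lemma oriented: "oriented H"
proof -
  have aux: False if e: "(T, h) \<in> star_edges V f A B" "(T', f h) \<in> star_edges V f A B"
    "insert h T = insert (f h) T'" for T h T'
  proof -
    obtain z where z: "T = {f h, z}" "h \<in> V" "z \<in> V" "z \<noteq> h" "z \<noteq> f h"
      "z = f (f h) \<Longrightarrow> h \<in> A"
      using e(1) by (rule star_edgesE) blast
    obtain y where y: "T' = {f (f h), y}" "y \<in> V" "y \<noteq> f h" "y \<noteq> f (f h)"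
      "y = f (f (f h)) \<Longrightarrow> f h \<in> A" "f y = f h \<Longrightarrow> y \<notin> A"
      using e(2) by (rule star_edgesE) blast
    have "f (f h) \<noteq> h" "f (f h) \<noteq> f h" using no_2cycle no_fix z(2) closed by blast+
    then have "z = f (f h)" using e(3) z y by auto
    moreover have "y = h" using e(3) z(1,4,5) y calculation no_fix[of h] by auto
    ultimately show False using y(6) z(6) by simp
  qed
  have "h = h'" if e: "(T, h) \<in> star_edges V f A B" "(T', h') \<in> star_edges V f A B"
    "insert h T = insert h' T'" for T h T' h'
  proof (rule ccontr)
    assume ne: "h \<noteq> h'"
    obtain z where z: "T = {f h, z}" "h \<in> V" "z \<in> V" "z \<noteq> h" "z \<noteq> f h"
      "f z = f h \<Longrightarrow> (h, z) \<in> B"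
      using e(1) by (rule star_edgesE) blast
    obtain y where y: "T' = {f h', y}" "h' \<in> V" "y \<in> V" "y \<noteq> h'" "y \<noteq> f h'"
      "f y = f h' \<Longrightarrow> (h', y) \<in> B"
      using e(2) by (rule star_edgesE) blast
    have a: "h' \<noteq> f h" "h \<noteq> f h'" using aux e by metis+
    have S: "{h, f h, z} = {h', f h', y}" using e(3) z(1) y(1) by simp
    have "h' \<in> {h, f h, z}" unfolding S by simp
    then have hz: "h' = z" using a ne by simp
    have "h \<in> {h', f h', y}" unfolding S[symmetric] by simp
    then have hy: "h = y" using a ne by simp
    have "f h \<in> {h', f h', y}" unfolding S[symmetric] by simp
    then have "f h = f h'" using a no_fix[OF z(2)] hy by auto
    then show False using B_antisym[OF z(2) y(2) ne] z(6) y(6) hz hy by auto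
  qed
  then show ?thesis unfolding oriented_iff[OF hgraph] by auto
qed

lemma hfree: "hfree I0 H"
proof -
  have "f h \<in> T" if "(T, h) \<in> star_edges V f A B" for T h
    using that by (auto elim: star_edgesE)
  then show ?thesis unfolding hfree_I0_iff[OF hgraph] by (metis disjoint_iff pre_hgraph.sel(2))
qed

definition "cyc3 = {x \<in> V. f (f (f x)) = x}"
definition "losses = {(x, z). x \<in> V \<and> z \<in> V \<and> z \<noteq> x \<and> f x = f z \<and> (x, z) \<notin> B}"

lemma finite_losses: "finite losses"
  by (rule finite_subset[of _ "V \<times> V"]) (auto simp: losses_def fin)

text \<open>
  The empty slots are \<open>(x, f (f x))\<close> for \<open>x \<notin> A\<close>, \<open>(f x, x)\<close> for \<open>x \<in> A\<close>, and the \<open>losses\<close>; the first two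
  kinds overlap exactly in the vertices of \<open>A\<close> on three-cycles.
\<close>

lemma card_star_edges:
  "card (star_edges V f A B) + card V + card losses = card V * (card V - 2) + card (A \<inter> cyc3)"
proof -
  define D1 where "D1 = (\<lambda>x. (x, f (f x))) ` (V - A)"
  define D2 where "D2 = (\<lambda>x. (f x, x)) ` (V \<inter> A)"
  define Sl where "Sl = (SIGMA x:V. V - {x, f x})"
  have "card (V - {x, f x}) = card V - 2" if "x \<in> V" for x
    using that closed[of x] no_fix[of x] fin by (simp add: card_Diff_subset)
  then have Sl: "card Sl = card V * (card V - 2)" "finite Sl"
    unfolding Sl_def using fin by (auto simp: card_SigmaI)
  have D1: "card D1 = card (V - A)" unfolding D1_def by (rule card_image) (auto simp: inj_on_def)
  have D2: "card D2 = card (V \<inter> A)" unfolding D2_def by (rule card_image) (auto simp: inj_on_def)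
  have fD: "finite D1" "finite D2" unfolding D1_def D2_def using fin by auto
  have "D1 \<inter> D2 = (\<lambda>x. (f x, x)) ` (A \<inter> cyc3)"
    unfolding D1_def D2_def cyc3_def using A_cycle closed by (auto simp: image_iff)
  then have D12: "card (D1 \<inter> D2) = card (A \<inter> cyc3)"
    by (simp add: card_image inj_on_def)
  have "card V = card (V \<inter> A) + card (V - A)"
    using fin by (metis card_Int_Diff)
  then have D: "card (D1 \<union> D2) + card (A \<inter> cyc3) = card V"
    using card_Un_Int[OF fD] D1 D2 D12 by simp
  have "(D1 \<union> D2) \<inter> losses = {}"
    unfolding D1_def D2_def losses_def using no_2cycle[OF closed] no_fix[OF closed] by auto metis+
  then have M: "card (D1 \<union> D2 \<union> losses) = card (D1 \<union> D2) + card losses"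
    using fD finite_losses by (intro card_Un_disjoint) auto
  have "D1 \<subseteq> Sl" unfolding D1_def Sl_def using no_2cycle no_fix closed by auto
  moreover have "D2 \<subseteq> Sl"
  proof
    fix p assume "p \<in> D2"
    then obtain x where "p = (f x, x)" "x \<in> V" unfolding D2_def by auto
    then show "p \<in> Sl" using no_2cycle[of x] no_fix[of x] closed[of x] unfolding Sl_def by auto
  qed
  moreover have "losses \<subseteq> Sl"
  proof
    fix p assume "p \<in> losses"
    then obtain x z where "p = (x, z)" "x \<in> V" "z \<in> V" "z \<noteq> x" "f x = f z"
      unfolding losses_def by auto
    then show "p \<in> Sl" using no_fix[of z] unfolding Sl_def by auto
  qed
  ultimately have sub: "D1 \<union> D2 \<union> losses \<subseteq> Sl" by blast
  have "star_edges V f A B = (\<lambda>(x, z). ({f x, z}, x)) ` (Sl - (D1 \<union> D2 \<union> losses))"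
    unfolding star_edges_def Sl_def D1_def D2_def losses_def
    by (rule arg_cong[where f="\<lambda>X. (\<lambda>(x, z). ({f x, z}, x)) ` X"]) (auto simp: image_iff)
  moreover have "inj_on (\<lambda>(x, z). ({f x, z}, x)) (Sl - (D1 \<union> D2 \<union> losses))"
    by (auto simp: inj_on_def doubleton_eq_iff)
  ultimately have "card (star_edges V f A B) = card (Sl - (D1 \<union> D2 \<union> losses))"
    by (simp add: card_image)
  also have "\<dots> = card Sl - card (D1 \<union> D2 \<union> losses)"
    using sub Sl(2) by (intro card_Diff_subset) (auto intro: finite_subset)
  finally show ?thesis
    using D M Sl(1) card_mono[OF Sl(2) sub] by linarith
qed

end

section \<open>Links and centres in a free oriented graph\<close>

text \<open>A pair missing \<open>a\<close> and a pair missing \<open>b\<close> complete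
  \<open>{a, b}\<close> to a triangle, and a pair that meets all three sides of a triangle is one of
  them.\<close>

lemma intersecting_pairs:
  assumes two: "\<And>T. T \<in> L \<Longrightarrow> card T = 2"
    and int: "\<And>S T. S \<in> L \<Longrightarrow> T \<in> L \<Longrightarrow> S \<inter> T \<noteq> {}"
    and no_centre: "\<And>y. \<exists>T\<in>L. y \<notin> T"
  shows "card L \<le> 3"
proof -
  obtain T1 where T1: "T1 \<in> L" using no_centre by blast
  obtain a b where ab: "T1 = {a, b}" "a \<noteq> b" using two[OF T1] by (auto simp: card_2_iff)
  obtain T2 where T2: "T2 \<in> L" "a \<notin> T2" using no_centre by blast
  have "b \<in> T2" using int[OF T1 T2(1)] T2(2) ab by auto
  then obtain c where c: "T2 = {b, c}" "b \<noteq> c" using two[OF T2(1)] by (auto simp: card_2_iff)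
  obtain T3 where T3: "T3 \<in> L" "b \<notin> T3" using no_centre by blast
  have "a \<in> T3" "c \<in> T3" using int[OF T1 T3(1)] int[OF T2(1) T3(1)] T3(2) ab c by auto
  moreover have ac: "a \<noteq> c" using T2 c by auto
  ultimately have T3': "T3 = {a, c}" using two[OF T3(1)] by (auto simp: card_2_iff)
  have "L \<subseteq> {{a, b}, {b, c}, {a, c}}"
  proof
    fix T assume T: "T \<in> L"
    have "T \<inter> {a, b} \<noteq> {}" "T \<inter> {b, c} \<noteq> {}" "T \<inter> {a, c} \<noteq> {}"
      using int[OF T T1] int[OF T T2(1)] int[OF T T3(1)] ab c T3' by auto
    then show "T \<in> {{a, b}, {b, c}, {a, c}}"
      using two[OF T] ab(2) c(2) ac by (auto simp: card_2_iff)
  qed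
  then have "card L \<le> card {{a, b}, {b, c}, {a, c}}" by (intro card_mono) auto
  also have "\<dots> \<le> 3" by (intro order_trans[OF card_insert_le_m1]) (auto simp: card_insert_if)
  finally show ?thesis .
qed

lemma UN_remove: "v \<in> I \<Longrightarrow> (\<Union>x\<in>I. X x) = X v \<union> (\<Union>x\<in>I - {v}. X x)"
  by auto

lemma card_UN_overlap:
  assumes "finite I" "\<And>i. i \<in> I \<Longrightarrow> finite (X i)" "\<And>i. i \<in> I \<Longrightarrow> card (X i) \<le> c"
    and "i \<in> I" "j \<in> I" "i \<noteq> j" "S \<in> X i" "S \<in> X j"
  shows "card (\<Union>i\<in>I. X i) + 1 \<le> card I * c"
proof -
  \<comment> \<open>The element \<open>S\<close> also lies in \<open>X i\<close>, so taking it out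
    of \<open>X j\<close> keeps the union and saves one.\<close>
  define Y where "Y k = (if k = j then X j - {S} else X k)" for k
  have "(\<Union>i\<in>I. X i) = (\<Union>i\<in>I. Y i)" using assms(4-8) unfolding Y_def by auto
  then have "card (\<Union>i\<in>I. X i) \<le> (\<Sum>i\<in>I. card (Y i))"
    using card_UN_le[OF assms(1), of Y] by simp
  also have "\<dots> < (\<Sum>i\<in>I. card (X i))"
  proof (rule sum_strict_mono_ex1[OF assms(1)])
    show "\<forall>k\<in>I. card (Y k) \<le> card (X k)"
      using assms(2) by (auto simp: Y_def intro: card_mono)
    show "\<exists>k\<in>I. card (Y k) < card (X k)"
      using card_Diff1_less[OF assms(2)[OF assms(5)] assms(8)] assms(5) by (auto simp: Y_def)
  qed
  also have "\<dots> \<le> card I * c" using sum_bounded_above[of I "\<lambda>i. card (X i)" c] assms(3) by simp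
  finally show ?thesis by simp
qed

locale free_hgraph =
  fixes H :: "'a pre_hgraph"
  assumes hg: "hgraph H" and ori: "oriented H" and fr: "hfree I0 H"
begin

abbreviation "V \<equiv> verts H"
abbreviation "E \<equiv> edges H"
abbreviation "n \<equiv> card V"

definition "link x = {T. (T, x) \<in> E}"
text \<open>A vertex that heads no edge has every other vertex as a centre. Lacking a centre
  therefore means, as soon as there are two vertices, that the tails have no common point.\<close>

definition "centre x y \<longleftrightarrow> y \<in> V \<and> y \<noteq> x \<and> (\<forall>T\<in>link x. y \<in> T)"

lemma finV: "finite V" using hg unfolding hgraph_def by auto

lemma finE: "finite E"
proof (rule finite_subset)
  show "E \<subseteq> Pow V \<times> V" using hg unfolding hgraph_def by auto
qed (use finV in auto)

lemma edgeD: "(T, h) \<in> E \<Longrightarrow> T \<subseteq> V \<and> card T = 2 \<and> h \<in> V \<and> h \<notin> T"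
  using hg unfolding hgraph_def by auto

lemma head_unique: "(T, h) \<in> E \<Longrightarrow> (T', h') \<in> E \<Longrightarrow> insert h T = insert h' T' \<Longrightarrow> h = h'"
  using ori oriented_iff[OF hg] by blast

lemma tails_meet: "(S, h) \<in> E \<Longrightarrow> (T, h) \<in> E \<Longrightarrow> S \<inter> T \<noteq> {}"
  using fr hfree_I0_iff[OF hg] by blast

lemma card_heads_in:
  assumes "D \<subseteq> V"
  shows "card {(T, h) \<in> E. h \<in> D} = (\<Sum>x\<in>D. card (link x))"
proof -
  have "finite (link x)" for x
  proof -
    have "link x \<subseteq> fst ` E" unfolding link_def by force
    then show ?thesis using finE finite_surj by blast
  qed
  moreover have "{(T, h) \<in> E. h \<in> D} = (\<lambda>(x, T). (T, x)) ` (SIGMA x:D. link x)"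
    unfolding link_def by auto
  moreover have "inj_on (\<lambda>(x, T). (T, x)) (SIGMA x:D. link x)" by (auto simp: inj_on_def)
  ultimately show ?thesis
    using finite_subset[OF assms finV] by (simp add: card_image card_SigmaI)
qed

lemma card_E: "card E = (\<Sum>x\<in>V. card (link x))"
proof -
  have "{(T, h) \<in> E. h \<in> V} = E" using edgeD by auto
  then show ?thesis using card_heads_in[of V] by simp
qed

lemma card_link_no_centre:
  assumes "x \<in> V" "n \<ge> 2" "\<nexists>y. centre x y"
  shows "card (link x) \<le> 3"
proof (rule intersecting_pairs)
  show "\<exists>T\<in>link x. y \<notin> T" for y
  proof (rule ccontr)
    assume all: "\<not> (\<exists>T\<in>link x. y \<notin> T)"
    show False
    proof (cases "link x = {}")
      case True
      obtain z where "z \<in> V" "z \<noteq> x" using assms(1,2) finV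
        by (metis One_nat_def card.empty card_insert_le_m1 card_le_Suc0_iff_eq not_less_eq_eq numeral_2_eq_2)
      then show False using assms(3) True unfolding centre_def by auto
    next
      case False
      then have "y \<in> V" "y \<noteq> x" using all edgeD unfolding link_def by auto
      then show False using assms(3) all unfolding centre_def by auto
    qed
  qed
qed (use edgeD tails_meet in \<open>auto simp: link_def\<close>)

lemma centre_tail:
  assumes "centre x y" "(T, x) \<in> E"
  obtains z where "T = {y, z}" "z \<in> V" "z \<noteq> x" "z \<noteq> y"
proof -
  have y: "y \<in> T" using assms unfolding centre_def link_def by auto
  have T: "T \<subseteq> V" "card T = 2" "x \<notin> T" using edgeD[OF assms(2)] by auto
  obtain z where "T = {y, z}" "z \<noteq> y" using y T(2) by (auto simp: card_2_iff)
  then show thesis using that T by auto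
qed

lemma card_Diff_2: "x \<in> V \<Longrightarrow> y \<in> V \<Longrightarrow> y \<noteq> x \<Longrightarrow> card (V - {x, y}) = n - 2"
  using finV by (simp add: card_Diff_subset)

text \<open>\<open>n \<ge> 5\<close> puts the bound 3 for links without a centre below
  \<open>n - 2\<close>.\<close>

lemma card_link_le:
  assumes "x \<in> V" "n \<ge> 5"
  shows "card (link x) \<le> n - 2"
proof (cases "\<exists>y. centre x y")
  case True
  then obtain y where y: "centre x y" by blast
  have "link x \<subseteq> (\<lambda>z. {y, z}) ` (V - {x, y})"
    using centre_tail[OF y] unfolding link_def by blast
  then have "card (link x) \<le> card (V - {x, y})"
    using finV by (meson surj_card_le finite_Diff)
  also have "\<dots> = n - 2" using y assms(1) unfolding centre_def by (intro card_Diff_2) auto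
  finally show ?thesis .
next
  case False
  then show ?thesis using card_link_no_centre[of x] assms by simp
qed

text \<open>Orientedness makes an edge recoverable from its triple, and the triple of an edge headed
  by \<open>x\<close> contains \<open>x\<close> and \<open>f x\<close>. Counting triples instead of
  slots exposes the waste when two vertices share triples.\<close>

lemma card_heads_cover:
  assumes D: "D \<subseteq> V" and f: "\<And>x. x \<in> D \<Longrightarrow> centre x (f x)"
  shows "card {(T, h) \<in> E. h \<in> D} \<le> card (\<Union>x\<in>D. (\<lambda>z. {x, f x, z}) ` (V - {x, f x}))"
proof -
  let ?X = "{(T, h) \<in> E. h \<in> D}"
  have "inj_on (\<lambda>(T, h). insert h T) ?X"
  proof (rule inj_onI, clarify)
    fix T h T' h' assume e: "(T, h) \<in> E" "(T', h') \<in> E" "insert h T = insert h' T'"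
    then have "h = h'" by (rule head_unique)
    moreover have "h \<notin> T" "h' \<notin> T'" using edgeD e by auto
    ultimately show "T = T' \<and> h = h'" using e(3) by auto
  qed
  moreover have "(\<lambda>(T, h). insert h T) ` ?X \<subseteq> (\<Union>x\<in>D. (\<lambda>z. {x, f x, z}) ` (V - {x, f x}))"
  proof clarify
    fix T h assume e: "(T, h) \<in> E" "h \<in> D"
    obtain z where "T = {f h, z}" "z \<in> V" "z \<noteq> h" "z \<noteq> f h"
      using centre_tail[OF f[OF e(2)] e(1)] .
    then show "insert h T \<in> (\<Union>x\<in>D. (\<lambda>z. {x, f x, z}) ` (V - {x, f x}))" using e(2) by blast
  qed
  ultimately show ?thesis
    using finV finite_subset[OF D finV] by (metis (no_types, lifting) card_inj_on_le finite_Diff finite_UN finite_imageI)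
qed

section \<open>Defects that keep a graph below the maximum\<close>

text \<open>
  The maximum will turn out to be \<open>n (n - 2) - n + n div 3\<close>, lowered by 1 unless 3 divides \<open>n\<close>. Staying
  2 below the first value, as in the bounds below, therefore excludes extremality.
\<close>

lemma two_no_centre_bound:
  assumes n: "n \<ge> 9" and w: "w \<in> V" "w' \<in> V" "w \<noteq> w'" "\<nexists>y. centre w y" "\<nexists>y. centre w' y"
  shows "card E + n + 2 \<le> n * (n - 2) + n div 3"
proof -
  have "card E = card (link w) + card (link w') + (\<Sum>x\<in>V - {w, w'}. card (link x))"
    using w(1-3) finV unfolding card_E by (simp add: sum.remove[of V w] sum.remove[of "V - {w}" w'] Diff_insert2[symmetric] insert_commute)
  also have "\<dots> \<le> 3 + 3 + card (V - {w, w'}) * (n - 2)"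
    using card_link_no_centre w n card_link_le
      sum_bounded_above[of "V - {w, w'}" "\<lambda>x. card (link x)" "n - 2"]
    by (intro add_mono) auto
  also have "card (V - {w, w'}) = n - 2" using w by (intro card_Diff_2) auto
  finally have *: "card E \<le> 6 + (n - 2) * (n - 2)" by simp
  define m where "m = n - 2"
  have m: "n = m + 2" using n by (simp add: m_def)
  \<comment> \<open>What remains is \<open>12 \<le> n + n div 3\<close>, an equality at
    \<open>n = 9\<close>.\<close>
  show ?thesis using * n unfolding m by (simp add: algebra_simps)
qed

lemma two_cycle_no_centre_bound:
  assumes n: "n \<ge> 9" and f: "\<And>x. x \<in> V \<Longrightarrow> x \<noteq> w \<Longrightarrow> centre x (f x)"
    and w: "w \<in> V" "\<nexists>y. centre w y" and u: "u \<in> V" "u \<noteq> w" "f u \<noteq> w" "f (f u) = u"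
  shows "card E + n + 2 \<le> n * (n - 2) + n div 3"
proof -
  let ?Tr = "\<lambda>x. (\<lambda>z. {x, f x, z}) ` (V - {x, f x})"
  have fu: "f u \<in> V" "f u \<noteq> u" using f[OF u(1,2)] unfolding centre_def by auto
  have Tr: "card (?Tr x) \<le> n - 2" if "x \<in> V - {w}" for x
    using that f[of x] card_Diff_2[of x "f x"] card_image_le[of "V - {x, f x}" "\<lambda>z. {x, f x, z}"] finV
    unfolding centre_def by auto
  have "?Tr u = ?Tr (f u)" using u(4) by (auto simp: insert_commute)
  then have "(\<Union>x\<in>V - {w}. ?Tr x) = (\<Union>x\<in>V - {w, u}. ?Tr x)" using u(3) fu by blast
  then have "card {(T, h) \<in> E. h \<in> V - {w}} \<le> card (\<Union>x\<in>V - {w, u}. ?Tr x)"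
    using card_heads_cover[of "V - {w}" f] f by auto
  also have "\<dots> \<le> (\<Sum>x\<in>V - {w, u}. card (?Tr x))" using finV by (intro card_UN_le) auto
  also have "\<dots> \<le> card (V - {w, u}) * (n - 2)"
    using Tr sum_bounded_above[of "V - {w, u}" "\<lambda>x. card (?Tr x)" "n - 2"] by auto
  also have "card (V - {w, u}) = n - 2" using w u by (intro card_Diff_2) auto
  finally have "(\<Sum>x\<in>V - {w}. card (link x)) \<le> (n - 2) * (n - 2)"
    using card_heads_in[of "V - {w}"] by auto
  moreover have "card E = card (link w) + (\<Sum>x\<in>V - {w}. card (link x))"
    using w finV unfolding card_E by (simp add: sum.remove)
  moreover have "card (link w) \<le> 3" using card_link_no_centre w n by auto
  ultimately have *: "card E \<le> 3 + (n - 2) * (n - 2)" by simp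
  define m where "m = n - 2"
  have m: "n = m + 2" using n by (simp add: m_def)
  show ?thesis using * n unfolding m by (simp add: algebra_simps)
qed

text \<open>Dropping one vertex of the two-cycle leaves \<open>(n - 1) * (n - 2)\<close> triples.
  That would suffice only for \<open>n div 3 \<ge> 4\<close>, so one further repeated triple is
  found to cover \<open>n = 9, 10, 11\<close>.\<close>

lemma two_cycle_bound:
  assumes n: "n \<ge> 9" and f: "\<And>x. x \<in> V \<Longrightarrow> centre x (f x)"
    and u: "u \<in> V" "f (f u) = u"
  shows "card E + n + 2 \<le> n * (n - 2) + n div 3"
proof -
  let ?Tr = "\<lambda>x. (\<lambda>z. {x, f x, z}) ` (V - {x, f x})"
  have fV: "f x \<in> V" "f x \<noteq> x" if "x \<in> V" for x using f[OF that] unfolding centre_def by auto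
  define v where "v = f u"
  have v: "v \<in> V" "v \<noteq> u" "f v = u" using fV[OF u(1)] u(2) by (auto simp: v_def)
  have Tr: "card (?Tr x) \<le> n - 2" if "x \<in> V" for x
    using card_image_le[of "V - {x, f x}" "\<lambda>z. {x, f x, z}"] finV
    unfolding card_Diff_2[OF that fV[OF that]] by simp
  have uv: "?Tr u = ?Tr v" by (simp add: v(3) v_def[symmetric] insert_commute)
  have "(\<Union>x\<in>V. ?Tr x) = ?Tr v \<union> (\<Union>x\<in>V - {v}. ?Tr x)" using v(1) by (rule UN_remove)
  also have "\<dots> = (\<Union>x\<in>V - {v}. ?Tr x)"
    unfolding uv[symmetric] by (rule Un_absorb1, rule UN_upper) (use u(1) v(2) in auto)
  finally have "card {(T, h) \<in> E. h \<in> V} \<le> card (\<Union>x\<in>V - {v}. ?Tr x)"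
    using card_heads_cover[of V f] f by auto
  moreover have "card (\<Union>x\<in>V - {v}. ?Tr x) + 1 \<le> card (V - {v}) * (n - 2)"
  proof -
    have "card (V - {u, v}) \<noteq> 0" using card_Diff_2[of u v] u v n by simp
    then have "V - {u, v} \<noteq> {}" by (metis card.empty)
    then obtain z where z: "z \<in> V" "z \<noteq> u" "z \<noteq> v" by blast
    \<comment> \<open>If \<open>z\<close> points into the two-cycle, the repeated triple is
      \<open>u, v, z\<close>. Otherwise \<open>z\<close> and \<open>f z\<close> share the triple
      \<open>z, f z, f (f z)\<close>, or all their triples if they form a two-cycle too.\<close>
    have "\<exists>y\<in>V - {v}. y \<noteq> z \<and> (\<exists>S. S \<in> ?Tr z \<and> S \<in> ?Tr y)"
    proof (cases "f z = u \<or> f z = v")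
      case True
      have a: "{u, v, z} \<in> ?Tr u" by (rule image_eqI[of _ _ z]) (use z in \<open>auto simp: v_def\<close>)
      from True have b: "{u, v, z} \<in> ?Tr z"
      proof
        assume "f z = u"
        then show ?thesis using z v(1,2) by (intro image_eqI[of _ _ v]) auto
      next
        assume "f z = v"
        then show ?thesis using z u(1) v(2) by (intro image_eqI[of _ _ u]) auto
      qed
      have c: "u \<in> V - {v}" "u \<noteq> z" using z u(1) v(2) by auto
      show ?thesis
        by (rule bexI[OF _ c(1)], rule conjI[OF c(2)], rule exI[of _ "{u, v, z}"], rule conjI[OF b a])
    next
      case False
      define y where "y = f z"
      have y: "y \<in> V" "y \<noteq> z" using fV[OF z(1)] by (auto simp: y_def)
      have "\<exists>S. S \<in> ?Tr z \<and> S \<in> ?Tr y"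
      proof (cases "f y = z")
        case True
        then have eq: "?Tr z = ?Tr y" by (simp add: y_def[symmetric] insert_commute)
        have "{z, f z, u} \<in> ?Tr z" by (rule image_eqI[of _ _ u]) (use u(1) z False in auto)
        then show ?thesis unfolding eq[symmetric] by (intro exI conjI)
      next
        case ne: False
        have "{z, f z, f y} \<in> ?Tr z"
          by (rule image_eqI[of _ _ "f y"]) (use fV[OF y(1)] ne in \<open>auto simp: y_def\<close>)
        moreover have "{z, f z, f y} \<in> ?Tr y"
          by (rule image_eqI[of _ _ z]) (use z y ne in \<open>auto simp: y_def\<close>)
        ultimately show ?thesis by (intro exI conjI)
      qed
      moreover have "y \<in> V - {v}" using y(1) False by (simp add: y_def)
      ultimately show ?thesis using y(2) by (intro bexI[of _ y] conjI)
    qed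
    then obtain y S where y: "y \<in> V - {v}" "y \<noteq> z" and S: "S \<in> ?Tr z" "S \<in> ?Tr y"
      by (elim bexE conjE exE)
    show ?thesis
      by (rule card_UN_overlap[OF _ _ _ _ y(1) y(2)[symmetric] S]) (use finV z Tr in simp_all)
  qed
  moreover have "card (V - {v}) = n - 1" using v(1) finV by simp
  moreover have "{(T, h) \<in> E. h \<in> V} = E" using edgeD by auto
  ultimately have *: "card E + 1 \<le> (n - 1) * (n - 2)" by simp
  define m where "m = n - 2"
  have m: "n = m + 2" using n by (simp add: m_def)
  have "n div 3 \<ge> 3" using n by simp
  then show ?thesis using * n unfolding m by (simp add: algebra_simps)
qed

text \<open>The at most three edges headed by \<open>w\<close> are outweighed by four empty slots
  among the \<open>(n - 1) * (n - 2)\<close> slots of the other vertices.\<close>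

lemma one_no_centre_bound:
  assumes n: "n \<ge> 9" and f: "\<And>x. x \<in> V \<Longrightarrow> x \<noteq> w \<Longrightarrow> centre x (f x)"
    and w: "w \<in> V" "\<nexists>y. centre w y"
    and no2: "\<And>x. x \<in> V \<Longrightarrow> x \<noteq> w \<Longrightarrow> f x \<noteq> w \<Longrightarrow> f (f x) \<noteq> x"
  shows "card E + n + 2 \<le> n * (n - 2) + n div 3"
proof -
  define Sl where "Sl = (SIGMA x:V - {w}. V - {x, f x})"
  define e where "e = (\<lambda>(x, z). ({f x, z}, x))"
  define M where "M = {p \<in> Sl. e p \<notin> E}"
  have fV: "f x \<in> V" "f x \<noteq> x" if "x \<in> V - {w}" for x using f[of x] that unfolding centre_def by auto
  have "card Sl = (\<Sum>x\<in>V - {w}. card (V - {x, f x}))"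
    unfolding Sl_def using finV by (simp add: card_SigmaI)
  also have "\<dots> = (\<Sum>x\<in>V - {w}. n - 2)" using fV by (intro sum.cong refl card_Diff_2) auto
  also have "\<dots> = (n - 1) * (n - 2)" using w(1) finV by simp
  finally have Sl: "card Sl = (n - 1) * (n - 2)" .
  have finSl: "finite Sl" unfolding Sl_def using finV by auto
  have "inj_on e (Sl - M)" unfolding e_def Sl_def by (auto simp: inj_on_def doubleton_eq_iff)
  have "{(T, h) \<in> E. h \<in> V - {w}} \<subseteq> e ` (Sl - M)"
  proof
    fix p assume p: "p \<in> {(T, h) \<in> E. h \<in> V - {w}}"
    obtain T h where Th: "p = (T, h)" by (cases p)
    have h: "(T, h) \<in> E" "h \<in> V" "h \<noteq> w" using p unfolding Th by auto
    obtain z where "T = {f h, z}" "z \<in> V" "z \<noteq> h" "z \<noteq> f h"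
      using centre_tail[OF f[OF h(2,3)] h(1)] .
    then show "p \<in> e ` (Sl - M)" using h unfolding Th by (intro image_eqI[of _ _ "(h, z)"]) (auto simp: e_def M_def Sl_def)
  qed
  then have "card {(T, h) \<in> E. h \<in> V - {w}} \<le> card (Sl - M)"
    using finSl surj_card_le by blast
  moreover have finM: "finite M" and "M \<subseteq> Sl" using finSl unfolding M_def by auto
  ultimately have le: "card {(T, h) \<in> E. h \<in> V - {w}} + card M \<le> (n - 1) * (n - 2)"
    using Sl card_Diff_subset[of M Sl] card_mono[OF finSl, of M] by linarith
  \<comment> \<open>Each vertex but \<open>w\<close> and at most one \<open>x0\<close> belongs to a pair in \<open>M\<close>, which forces \<open>card M \<ge> 4\<close>.\<close>
  have miss: "v \<in> fst ` M \<union> snd ` M"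
    if v: "v \<in> V" "v' \<in> V" "v \<noteq> w" "v' \<noteq> w" "v \<noteq> v'"
      and y: "{f v, y} \<union> {v} = {f v', y'} \<union> {v'}" "{y, y'} \<subseteq> V" "y \<notin> {v, f v}" "y' \<notin> {v', f v'}" "v \<in> {v', y'}"
    for v v' y y'
  proof -
    have "\<not> (e (v, y) \<in> E \<and> e (v', y') \<in> E)"
      using head_unique[of "{f v, y}" v "{f v', y'}" v'] v(5) y(1) unfolding e_def by auto
    then have "(v, y) \<in> M \<or> (v', y') \<in> M" using v y unfolding M_def Sl_def by auto
    then show ?thesis using v(5) y(5) by force
  qed
  \<comment> \<open>The slots \<open>(v, f (f v))\<close> and \<open>(f v, v)\<close> lie on the
    same triple, and both contain \<open>v\<close>.\<close>
  have m1: "v \<in> fst ` M \<union> snd ` M" if v: "v \<in> V" "v \<noteq> w" "f v \<noteq> w" for v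
  proof (rule miss[of v "f v" "f (f v)" v])
    have "f v \<in> V - {w}" using fV[of v] v by auto
    then show "{f (f v), v} \<subseteq> V" "f (f v) \<notin> {v, f v}" using fV[of "f v"] no2[OF v] v by auto
    show "v \<notin> {f v, f (f v)}" using no2[OF v] fV[of v] v by auto
    show "{f v, f (f v)} \<union> {v} = {f (f v), v} \<union> {f v}" by auto
    show "v \<in> {f v, v}" by simp
  qed (use v fV[of v] in auto)
  \<comment> \<open>The slots \<open>(v, x0)\<close> and \<open>(x0, v)\<close> both lie on the
    triple \<open>v, x0, w\<close>.\<close>
  have m2: "v \<in> fst ` M \<union> snd ` M" if v: "v \<in> V" "v \<noteq> w" "f v = w" "x0 \<in> V" "x0 \<noteq> w" "f x0 = w" "v \<noteq> x0" for v x0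
    by (rule miss[of v x0 x0 v]) (use v in auto)
  obtain x0 where x0: "V - {w, x0} \<subseteq> fst ` M \<union> snd ` M"
  proof (cases "\<exists>x0\<in>V - {w}. f x0 = w")
    case True
    then show thesis using m1 m2 that by blast
  next
    case False
    then show thesis using m1 that[of w] by auto
  qed
  have "card (V - {w, x0}) \<le> card (fst ` M \<union> snd ` M)"
    using x0 finM by (intro card_mono) auto
  also have "\<dots> \<le> card M + card M"
    using card_Un_le[of "fst ` M" "snd ` M"] card_image_le[OF finM, of fst] card_image_le[OF finM, of snd] by linarith
  finally have "n - 2 \<le> card M + card M"
    using diff_card_le_card_Diff[of "{w, x0}" V] card_insert_le_m1[of 2 "{x0}" w] by simp
  \<comment> \<open>Each pair in \<open>M\<close> accounts for at most two vertices, and half of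
    \<open>n - 2 \<ge> 7\<close> rounds up to 4.\<close>
  then have M4: "card M \<ge> 4" using n by linarith
  have "card E = card (link w) + (\<Sum>x\<in>V - {w}. card (link x))"
    using w finV unfolding card_E by (simp add: sum.remove)
  moreover have "card (link w) \<le> 3" using card_link_no_centre w n by auto
  ultimately have *: "card E + 1 \<le> (n - 1) * (n - 2)"
    using le M4 unfolding card_heads_in[OF Diff_subset[of V "{w}"]] by linarith
  define m where "m = n - 2"
  have m: "n = m + 2" using n by (simp add: m_def)
  have "n div 3 \<ge> 3" using n by simp
  then show ?thesis using * n unfolding m by (simp add: algebra_simps)
qed

section \<open>Graphs without defects lie inside a graph built from \<open>f\<close>\<close>

text \<open>With \<open>A\<close> and \<open>B\<close> read off from the edges, orientedness gives
  both their axioms and the conditions on each slot in use. Only an inclusion results, since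
  \<open>E\<close> may leave slots empty for no reason.\<close>

lemma star_frame_if_centres:
  assumes f: "\<And>x. x \<in> V \<Longrightarrow> centre x (f x)" and no2: "\<And>x. x \<in> V \<Longrightarrow> f (f x) \<noteq> x"
  defines "A \<equiv> {x. ({f x, f (f x)}, x) \<in> E}" and "B \<equiv> {(x, z). ({f x, z}, x) \<in> E}"
  shows "star_frame V f A B" "E \<subseteq> star_edges V f A B"
proof -
  have fV: "f x \<in> V" "f x \<noteq> x" if "x \<in> V" for x using f[OF that] unfolding centre_def by auto
  show "star_frame V f A B"
  proof
    fix x assume x: "x \<in> V" "f (f (f x)) = x" "x \<in> A"
    show "f x \<notin> A"
    proof
      assume "f x \<in> A"
      then show False
        using head_unique[of "{f x, f (f x)}" x "{f (f x), f (f (f x))}" "f x"] x fV[OF x(1)]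
        unfolding A_def by (auto simp: insert_commute)
    qed
  next
    fix x y assume x: "x \<in> V" "y \<in> V" "x \<noteq> y" "f x = f y" "(x, y) \<in> B"
    show "(y, x) \<notin> B"
      using head_unique[of "{f x, y}" x "{f y, x}" y] x unfolding B_def by (auto simp: insert_commute)
  qed (use fV no2 finV in auto)
  show "E \<subseteq> star_edges V f A B"
  proof clarify
    fix T h assume e: "(T, h) \<in> E"
    have h: "h \<in> V" using edgeD[OF e] by simp
    obtain z where z: "T = {f h, z}" "z \<in> V" "z \<noteq> h" "z \<noteq> f h"
      using centre_tail[OF f[OF h] e] .
    have "z \<notin> A" if "f z = h"
    proof
      assume "z \<in> A"
      then show False using head_unique[of T h "{f z, f (f z)}" z] e z that
        unfolding A_def by (auto simp: insert_commute)
    qed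
    then show "(T, h) \<in> star_edges V f A B"
      using e h z unfolding star_edges_def A_def B_def by (intro image_eqI[of _ _ "(h, z)"]) auto
  qed
qed

lemma star_frame_or_few_edges:
  assumes n: "n \<ge> 9"
  shows "card E + n + 2 \<le> n * (n - 2) + n div 3 \<or>
    (\<exists>f A B. star_frame V f A B \<and> E \<subseteq> star_edges V f A B)"
proof (cases "\<exists>w\<in>V. \<nexists>y. centre w y")
  case True
  then obtain w where w: "w \<in> V" "\<nexists>y. centre w y" by blast
  show ?thesis
  proof (cases "\<exists>w'\<in>V - {w}. \<nexists>y. centre w' y")
    case True
    then show ?thesis using two_no_centre_bound[OF n] w by blast
  next
    case False
    then obtain f where f: "\<And>x. x \<in> V \<Longrightarrow> x \<noteq> w \<Longrightarrow> centre x (f x)"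
      by (metis Diff_iff singletonD)
    show ?thesis
      using two_cycle_no_centre_bound[OF n f w] one_no_centre_bound[OF n f w] by blast
  qed
next
  case False
  then obtain f where f: "\<And>x. x \<in> V \<Longrightarrow> centre x (f x)" by metis
  show ?thesis
    using two_cycle_bound[OF n f] star_frame_if_centres[OF f] by blast
qed

end

section \<open>Three-cycles with a head, and the core around which they are arranged\<close>

context star_frame begin

definition "apex = A \<inter> cyc3"
text \<open>A three-cycle without a vertex of \<open>A\<close> saves no slot; only those with one,
  its \<open>apex\<close>, are collected here.\<close>

definition "triangles = apex \<union> f ` apex \<union> f ` f ` apex"

text \<open>The core is the path \<open>c 0, c 1, ..., c (s - 1)\<close> closed up at
  \<open>c j\<close>. For \<open>j = s - 3\<close> its final part is a three-cycle, and the last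
  clause gives that cycle an apex. For \<open>s = 3\<close> the core is simply one of the
  \<open>triangles\<close>.\<close>

definition "core c s j \<longleftrightarrow> inj_on c {..<s} \<and> c ` {..<s} \<subseteq> V \<and>
  (\<forall>i<s. f (c i) = c (if Suc i = s then j else Suc i)) \<and>
  V - c ` {..<s} \<subseteq> triangles \<and> (j = s - 3 \<longrightarrow> c j \<in> triangles)"

lemma apexD: "x \<in> apex \<Longrightarrow> x \<in> V \<and> x \<in> A \<and> f (f (f x)) = x"
  unfolding apex_def cyc3_def by auto

lemma apex_next: assumes "x \<in> apex" shows "f x \<notin> A" "f (f x) \<notin> A"
proof -
  have x: "x \<in> V" "x \<in> A" "f (f (f x)) = x" using apexD[OF assms] by auto
  show "f x \<notin> A" using A_cycle x by blast
  show "f (f x) \<notin> A" using A_cycle[of "f (f x)"] x closed by auto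
qed

lemma triangles_cyc3: "x \<in> triangles \<Longrightarrow> x \<in> V \<and> f (f (f x)) = x"
  unfolding triangles_def using apexD closed by auto

lemma triangles_closed: "x \<in> triangles \<Longrightarrow> f x \<in> triangles"
  unfolding triangles_def using apexD by auto

lemma card_triangles: "card triangles = 3 * card apex"
proof -
  have fin: "finite apex" unfolding apex_def cyc3_def using fin by auto
  have inj: "inj_on f apex" "inj_on f (f ` apex)"
    by (auto simp: inj_on_def) (metis apexD)+
  have "apex \<inter> f ` apex = {}" "(apex \<union> f ` apex) \<inter> f ` f ` apex = {}"
  proof -
    show "apex \<inter> f ` apex = {}" using apex_next(1) apexD by blast
    have "f x \<noteq> f (f y)" if "x \<in> apex" "y \<in> apex" for x y
    proof
      assume "f x = f (f y)"
      then have "f (f (f x)) = f (f (f (f y)))" by simp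
      then have "x = f y" using apexD that by metis
      then show False using apexD[OF that(1)] apex_next(1)[OF that(2)] by simp
    qed
    then show "(apex \<union> f ` apex) \<inter> f ` f ` apex = {}"
      using apex_next(2) apexD by blast
  qed
  then show ?thesis
    using fin unfolding triangles_def by (simp add: card_Un_disjoint card_image inj)
qed

lemma triangles_one_apex:
  assumes "a \<in> triangles"
  shows "a \<in> A \<and> f a \<notin> A \<and> f (f a) \<notin> A \<or> a \<notin> A \<and> f a \<in> A \<and> f (f a) \<notin> A
    \<or> a \<notin> A \<and> f a \<notin> A \<and> f (f a) \<in> A"
  using assms apex_next apexD unfolding triangles_def by fastforce

lemma lossesI:
  assumes "x \<in> V" "y \<in> V" "x \<noteq> y" "f x = f y"
  shows "(x, y) \<in> losses \<or> (y, x) \<in> losses"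
  using assms B_antisym[OF assms] unfolding losses_def by auto

lemma core_rho4:
  assumes a: "a \<in> triangles" and q: "V - triangles = {q}" "f q = a"
  shows "core (\<lambda>i. [q, a, f a, f (f a)] ! i) 4 1"
proof -
  have tri: "f a \<in> triangles" "f (f a) \<in> triangles" using a triangles_closed by auto
  have V: "a \<in> V" "f a \<in> V" "f (f a) \<in> V" "q \<in> V" "f (f (f a)) = a"
    using a closed q triangles_cyc3[OF a] by auto
  have "q \<notin> triangles" using q by auto
  then have ne: "q \<noteq> a" "q \<noteq> f a" "q \<noteq> f (f a)" "a \<noteq> f a" "a \<noteq> f (f a)" "f a \<noteq> f (f a)"
    using a tri no_fix[of a] no_2cycle[of a] no_fix[of "f a"] V by auto
  have 4: "{..<4} = {0, 1, 2, 3::nat}" by auto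
  show ?thesis unfolding core_def 4
    using V ne q a by (auto simp: numeral_eq_Suc less_Suc_eq)
qed

lemma core_rho5:
  assumes a: "a \<in> triangles" and q: "V - triangles = {p, q}" "p \<noteq> q" "f p = q" "f q = a"
  shows "core (\<lambda>i. [p, q, a, f a, f (f a)] ! i) 5 2"
proof -
  have tri: "f a \<in> triangles" "f (f a) \<in> triangles" using a triangles_closed by auto
  have V: "a \<in> V" "f a \<in> V" "f (f a) \<in> V" "p \<in> V" "q \<in> V" "f (f (f a)) = a"
    using a closed q triangles_cyc3[OF a] by auto
  have "q \<notin> triangles" "p \<notin> triangles" using q by auto
  then have ne: "q \<noteq> a" "q \<noteq> f a" "q \<noteq> f (f a)" "a \<noteq> f a" "a \<noteq> f (f a)" "f a \<noteq> f (f a)"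
    "p \<noteq> a" "p \<noteq> f a" "p \<noteq> f (f a)"
    using a tri no_fix[of a] no_2cycle[of a] no_fix[of "f a"] V by auto
  have 5: "{..<5} = {0, 1, 2, 3, 4::nat}" by auto
  show ?thesis unfolding core_def 5
    using V ne q a by (auto simp: numeral_eq_Suc less_Suc_eq)
qed

lemma core_triangle:
  assumes a: "a \<in> triangles" and V: "V = triangles"
  shows "core (\<lambda>i. [a, f a, f (f a)] ! i) 3 0"
proof -
  have V: "a \<in> V" "f a \<in> V" "f (f a) \<in> V" "f (f (f a)) = a"
    using a closed triangles_cyc3[OF a] by auto
  have ne: "a \<noteq> f a" "a \<noteq> f (f a)" "f a \<noteq> f (f a)"
    using no_fix[of a] no_2cycle[of a] no_fix[of "f a"] V by auto
  have 3: "{..<3} = {0, 1, 2::nat}" by auto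
  show ?thesis unfolding core_def 3
    using V ne assms by (auto simp: numeral_eq_Suc less_Suc_eq)
qed

text \<open>A vertex of \<open>triangles\<close> has its preimage inside its own three-cycle, and
  injectivity allows no second one.\<close>

lemma not_triangles_closed:
  assumes inj: "inj_on f V" and x: "x \<in> V - triangles"
  shows "f x \<in> V - triangles"
proof -
  have "f x \<notin> triangles"
  proof
    assume t: "f x \<in> triangles"
    then have "f (f (f (f x))) = f x" using triangles_cyc3 by blast
    moreover have y: "f (f (f x)) \<in> triangles" using t triangles_closed by blast
    ultimately have "f (f (f x)) = x" using inj x triangles_cyc3 unfolding inj_on_def by blast
    then show False using y x by simp
  qed
  then show ?thesis using x closed by auto
qed

text \<open>The only way to fail is \<open>card apex = card V div 3\<close> without losses although
  3 does not divide \<open>card V\<close>. Then \<open>f\<close> is injective and maps the one or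
  two vertices outside \<open>triangles\<close> among themselves, which forces a fixed point or a
  two-cycle.\<close>

lemma card_apex_le: "card apex + (if card V mod 3 = 0 then 0 else 1) \<le> card V div 3 + card losses"
proof -
  have triV: "triangles \<subseteq> V" using triangles_cyc3 by auto
  then have le: "3 * card apex \<le> card V" using card_triangles card_mono[OF fin triV] by simp
  show ?thesis
  proof (rule ccontr)
    assume neg: "\<not> ?thesis"
    have "card apex \<le> card V div 3" using le by linarith
    then have r: "card V mod 3 \<noteq> 0" "card apex = card V div 3" "card losses = 0"
      using neg by (auto split: if_splits)
    moreover have "3 * card apex + card V mod 3 = card V" unfolding r(2) by simp
    moreover have "inj_on f V" using lossesI finite_losses r(3) unfolding inj_on_def by auto
    moreover have "card (V - triangles) = card V - 3 * card apex"
      using card_triangles finite_subset[OF triV fin] by (simp add: card_Diff_subset[OF _ triV])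
    ultimately have c: "inj_on f V" "card (V - triangles) = 1 \<or> card (V - triangles) = 2"
      using r(1) by (simp, linarith)
    have "\<exists>x\<in>V - triangles. f x = x \<or> f (f x) = x"
      using c(2)
    proof
      assume "card (V - triangles) = 1"
      then show ?thesis using not_triangles_closed[OF c(1)] by (auto simp: card_1_singleton_iff)
    next
      assume "card (V - triangles) = 2"
      then obtain p q where "V - triangles = {p, q}" by (auto simp: card_2_iff)
      then show ?thesis
        using not_triangles_closed[OF c(1), of p] not_triangles_closed[OF c(1), of q] by auto
    qed
    then show False using no_fix no_2cycle by auto
  qed
qed

text \<open>Here \<open>f\<close> permutes 4 or 5 vertices in cycles of length at least 3, and there
  is no room for two such cycles.\<close>

lemma core_cycle:
  assumes inj: "inj_on f V" and U: "card (V - triangles) = s" "s = 4 \<or> s = 5"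
  shows "\<exists>c. core c s 0"
proof -
  define U where "U = V - triangles"
  have fU: "f x \<in> U" if "x \<in> U" for x
    using not_triangles_closed[OF inj] that unfolding U_def .
  have UV: "x \<in> V" if "x \<in> U" for x using that unfolding U_def by auto
  have injU: "f x = f y \<longleftrightarrow> x = y" if "x \<in> U" "y \<in> U" for x y
    using inj that UV unfolding inj_on_def by blast
  have nf: "f x \<noteq> x" "f (f x) \<noteq> x" if "x \<in> U" for x using no_fix no_2cycle UV that by auto
  have finU: "finite U" "card U = s" using U fin unfolding U_def by auto
  obtain a where a: "a \<in> U" using finU U(2) by fastforce
  define b where "b = f a" define c where "c = f b" define d where "d = f c"
  have in_U: "a \<in> U" "b \<in> U" "c \<in> U" "d \<in> U" using a fU by (auto simp: b_def c_def d_def)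
  have abc: "a \<noteq> b" "a \<noteq> c" "b \<noteq> c" using nf in_U by (metis b_def c_def)+
  have d1: "d \<noteq> b" "d \<noteq> c" using nf in_U by (metis c_def d_def)+
  \<comment> \<open>Since \<open>X\<close> contains a preimage of each of its elements, injectivity
    keeps the vertices outside \<open>X\<close> outside.\<close>
  have rest: "\<exists>y\<in>U - X. y \<noteq> x \<and> y = f x \<and> f y \<noteq> x" if X: "\<And>y. y \<in> X \<Longrightarrow> \<exists>z\<in>X. f z = y" "X \<subseteq> U" and x: "x \<in> U - X" for X x
  proof (intro bexI conjI)
    show "f x \<in> U - X" using X fU[of x] injU x by (metis DiffD1 DiffD2 DiffI subsetD)
  qed (use x nf in auto)
  have d2: "d \<noteq> a"
  proof
    assume da: "d = a"
    let ?X = "{a, b, c}"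
    have X: "\<exists>z\<in>?X. f z = y" if "y \<in> ?X" for y using that da by (auto simp: b_def c_def d_def)
    have "card (U - ?X) = s - 3" using abc in_U finU by (simp add: card_Diff_subset)
    then have cU: "card (U - ?X) \<noteq> 0" "card (U - ?X) \<le> 2" using U(2) by linarith+
    from cU(1) have "U - ?X \<noteq> {}" by (metis card.empty)
    then obtain x where x: "x \<in> U - ?X" by blast
    obtain y where y: "y \<in> U - ?X" "y \<noteq> x" "y = f x" "f y \<noteq> x" using rest[OF X _ x] in_U by blast
    obtain z where z: "z \<in> U - ?X" "z \<noteq> y" "z = f y" using rest[OF X _ y(1)] in_U by blast
    have "card {x, y, z} \<le> card (U - ?X)" using x y z finU by (intro card_mono) auto
    moreover have "card {x, y, z} = 3" using y z by auto
    ultimately show False using cU(2) by linarith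
  qed
  show ?thesis
  proof (cases "s = 4")
    case True
    have "card {a, b, c, d} = 4" using abc d1 d2 by auto
    then have Ueq: "U = {a, b, c, d}" using in_U finU True by (intro card_subset_eq[symmetric]) auto
    have "f d \<noteq> b" "f d \<noteq> c" "f d \<noteq> d" using injU in_U d1 d2 nf by (metis b_def c_def)+
    then have da: "f d = a" using fU[OF in_U(4)] Ueq by auto
    have 4: "{..<4} = {0, 1, 2, 3::nat}" by auto
    have "core (\<lambda>i. [a, b, c, d] ! i) 4 0" unfolding core_def 4
      using in_U UV Ueq da abc d1 d2 by (auto simp: numeral_eq_Suc less_Suc_eq b_def c_def d_def U_def)
    then show ?thesis using True by blast
  next
    case False
    then have s: "s = 5" using U by auto
    define e where "e = f d"
    have eU: "e \<in> U" using in_U fU e_def by auto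
    have e1: "e \<noteq> b" "e \<noteq> c" "e \<noteq> d" using injU in_U d1 d2 nf by (metis b_def c_def e_def)+
    have e2: "e \<noteq> a"
    proof
      assume ea: "e = a"
      let ?X = "{a, b, c, d}"
      have X: "\<exists>z\<in>?X. f z = y" if "y \<in> ?X" for y using that ea by (auto simp: b_def c_def d_def e_def)
      have "card (U - ?X) = 1" using abc d1 d2 in_U finU s by (simp add: card_Diff_subset)
      then obtain x where x: "U - ?X = {x}" by (auto simp: card_1_singleton_iff)
      then show False using rest[OF X, of x] in_U by blast
    qed
    have "card {a, b, c, d, e} = 5" using abc d1 d2 e1 e2 by auto
    then have Ueq: "U = {a, b, c, d, e}" using in_U eU finU s by (intro card_subset_eq[symmetric]) auto
    have "f e \<noteq> b" "f e \<noteq> c" "f e \<noteq> d" "f e \<noteq> e"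
      using injU in_U eU d1 d2 e1 e2 nf by (metis b_def c_def d_def)+
    then have ea: "f e = a" using fU[OF eU] Ueq by auto
    have 5: "{..<5} = {0, 1, 2, 3, 4::nat}" by auto
    have "core (\<lambda>i. [a, b, c, d, e] ! i) 5 0" unfolding core_def 5
      using in_U eU UV Ueq ea abc d1 d2 e1 e2 by (auto simp: numeral_eq_Suc less_Suc_eq b_def c_def d_def e_def U_def)
    then show ?thesis using s by blast
  qed
qed

text \<open>\<open>many\<close> is the reverse of \<open>card_apex_le\<close>, hence the case of
  equality. For \<open>s > 3\<close> the spare unit pays either for a missing apex, with no losses
  and the \<open>s\<close> leftover vertices on one cycle, or for at most one loss, with
  \<open>s - 3\<close> vertices left over that lead into a three-cycle.\<close>

lemma core_exists:
  assumes n: "V \<noteq> {}" and s: "s = 3 + card V mod 3"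
    and many: "card V div 3 + card losses \<le> card apex + (if card V mod 3 = 0 then 0 else 1)"
  shows "\<exists>c. core c s 0 \<or> s > 3 \<and> core c s (s - 3) \<and>
    ((c (s - 4), c (s - 1)) \<in> B \<longleftrightarrow> (c (s - 1), c (s - 4)) \<notin> B)"
proof -
  define k where "k = card V div 3"
  have triV: "triangles \<subseteq> V" using triangles_cyc3 by auto
  have fint: "finite triangles" using triV fin finite_subset by auto
  have nk: "card V = 3 * k + (s - 3)" "s - 3 \<le> 2" unfolding k_def s by auto
  have le: "3 * card apex \<le> card V" using card_triangles card_mono[OF fin triV] by simp
  have U: "card (V - triangles) = card V - 3 * card apex"
    using card_triangles triV fint by (simp add: card_Diff_subset)
  consider (tri) "s = 3" | (cyc) "s \<noteq> 3" "card apex + 1 = k" | (rho) "s \<noteq> 3" "card apex = k"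
  proof (cases "s = 3")
    case False
    have "card apex \<le> k" using le nk by linarith
    moreover have "k + card losses \<le> card apex + 1"
      using many unfolding k_def[symmetric] by (rule order_trans) simp
    ultimately have "card apex + 1 = k \<or> card apex = k" by linarith
    then show thesis using that(2)[OF False] that(3)[OF False] by (elim disjE)
  qed (rule that(1))
  then show ?thesis
  proof cases
    case tri
    then have "card V mod 3 = 0" using s by simp
    then have "card apex = k" using many le nk(1) tri unfolding k_def[symmetric] by simp
    then have "card (V - triangles) = 0" using U nk tri by simp
    then have V: "V = triangles" using triV fin by auto
    then obtain a where "a \<in> triangles" using n by blast
    then show ?thesis using core_triangle[OF _ V] tri by blast
  next
    case cyc
    have "k + card losses \<le> card apex + 1"
      using many unfolding k_def[symmetric] by (rule order_trans) simp
    then have "losses = {}" using cyc(2) finite_losses by simp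
    then have "inj_on f V" using lossesI unfolding inj_on_def by blast
    moreover have "card (V - triangles) = s" using U nk(1) cyc(2) s by linarith
    moreover have "s = 4 \<or> s = 5" using nk(2) cyc(1) s by linarith
    ultimately show ?thesis using core_cycle by blast
  next
    case rho
    have "k + card losses \<le> card apex + 1"
      using many unfolding k_def[symmetric] by (rule order_trans) simp
    then have l1: "card losses \<le> 1" using rho(2) by simp
    have Us: "card (V - triangles) = s - 3" using U nk rho by simp
    \<comment> \<open>A colliding pair with neither slot in use would count as two losses.\<close>
    have B_iff: "(x, y) \<in> B \<longleftrightarrow> (y, x) \<notin> B" if "x \<in> V" "y \<in> V" "x \<noteq> y" "f x = f y" for x y
    proof -
      have "\<not> ((x, y) \<in> losses \<and> (y, x) \<in> losses)"
        using l1 finite_losses that(3) by (auto simp: card_le_Suc0_iff_eq)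
      then show ?thesis using B_antisym[OF that] that unfolding losses_def by auto
    qed
    have B_q: "(q, f (f a)) \<in> B \<longleftrightarrow> (f (f a), q) \<notin> B" if "q \<in> V - triangles" "f q = a" "a \<in> triangles" for q a
    proof (rule B_iff)
      have "f (f a) \<in> triangles" using that triangles_closed by auto
      then show "f (f a) \<in> V" "q \<noteq> f (f a)" using triV that by auto
      show "f q = f (f (f a))" using that triangles_cyc3 by auto
    qed (use that in auto)
    consider "s = 4" | "s = 5" using rho(1) nk(2) s by linarith
    then show ?thesis
    proof cases
      case 1
      then obtain q where q: "V - triangles = {q}" using Us by (auto simp: card_1_singleton_iff)
      then have "f q \<in> V" "f q \<noteq> q" using closed no_fix by auto
      then have "f q \<in> triangles" using q by auto
      then show ?thesis using core_rho4[OF _ q refl] B_q[of q "f q"] q 1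
        by (intro exI[of _ "\<lambda>i. [q, f q, f (f q), f (f (f q))] ! i"]) auto
    next
      case 2
      then obtain p q where pq: "V - triangles = {p, q}" "p \<noteq> q" using Us by (auto simp: card_2_iff)
      have *: ?thesis if pq: "V - triangles = {p, q}" "p \<noteq> q" "f q \<in> triangles" "f p = q" for p q
        using core_rho5[OF pq(3) pq(1,2,4) refl] B_q[of q "f q"] that 2
        by (intro exI[of _ "\<lambda>i. [p, q, f q, f (f q), f (f (f q))] ! i"]) auto
      have V: "p \<in> V" "q \<in> V" "f p \<in> V" "f q \<in> V" "f p \<noteq> p" "f q \<noteq> q" "f (f p) \<noteq> p"
        using pq closed no_fix no_2cycle by auto
      \<comment> \<open>A vertex that points into \<open>triangles\<close> from outside collides
        with the predecessor of its image there. Two such vertices would cause two different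
        losses.\<close>
      have "\<not> (f p \<in> triangles \<and> f q \<in> triangles)"
      proof
        assume t: "f p \<in> triangles \<and> f q \<in> triangles"
        then have tt: "f (f (f p)) \<in> triangles" "f (f (f q)) \<in> triangles"
          "f (f (f (f p))) = f p" "f (f (f (f q))) = f q"
          using triangles_closed triangles_cyc3 by auto
        have nt: "p \<notin> triangles" "q \<notin> triangles" using pq by auto
        then have "p \<noteq> f (f (f p))" "q \<noteq> f (f (f q))" using tt(1,2) by auto
        then have "(p, f (f (f p))) \<in> losses \<or> (f (f (f p)), p) \<in> losses"
          "(q, f (f (f q))) \<in> losses \<or> (f (f (f q)), q) \<in> losses"
          using V tt(3,4)[symmetric] subsetD[OF triV tt(1)] subsetD[OF triV tt(2)]
            lossesI[of p "f (f (f p))"] lossesI[of q "f (f (f q))"] by blast+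
        moreover note nt
        moreover have "u = v" if "u \<in> losses" "v \<in> losses" for u v
          using l1 finite_losses that by (auto simp: card_le_Suc0_iff_eq)
        ultimately show False using tt pq(2) by (metis prod.inject)
      qed
      moreover have "f p \<in> triangles \<or> f p = q" "f q \<in> triangles \<or> f q = p" using V pq by auto
      ultimately consider "f q \<in> triangles" "f p = q" | "f p \<in> triangles" "f q = p"
        using V(7) by fastforce
      then show ?thesis
      proof cases
        case 1
        then show ?thesis using *[OF pq] by blast
      next
        case 2
        then show ?thesis using *[of q p] pq by (simp add: insert_commute)
      qed
    qed
  qed
qed

end

section \<open>Isomorphisms as conjugacies of the maps\<close>

text \<open>Whether a slot is filled depends only on \<open>f\<close>, \<open>A\<close> and the
  values of \<open>B\<close> at collisions.\<close>

lemma hiso_star_edgesI: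
  assumes F: "star_frame V f A B" and F': "star_frame V' f' A' B'"
    and bij: "bij_betw \<phi> V V'"
    and f: "\<And>x. x \<in> V \<Longrightarrow> \<phi> (f x) = f' (\<phi> x)"
    and A: "\<And>x. x \<in> V \<Longrightarrow> x \<in> A \<longleftrightarrow> \<phi> x \<in> A'"
    and B: "\<And>x y. x \<in> V \<Longrightarrow> y \<in> V \<Longrightarrow> x \<noteq> y \<Longrightarrow> f x = f y \<Longrightarrow> (x, y) \<in> B \<longleftrightarrow> (\<phi> x, \<phi> y) \<in> B'"
  shows "hiso (HGraph V (star_edges V f A B)) (HGraph V' (star_edges V' f' A' B'))"
proof -
  interpret F: star_frame V f A B by (rule F)
  interpret F': star_frame V' f' A' B' by (rule F')
  have inj: "\<phi> x = \<phi> y \<longleftrightarrow> x = y" if "x \<in> V" "y \<in> V" for x y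
    using bij that by (auto simp: bij_betw_def inj_on_def)
  have V': "\<phi> x \<in> V'" if "x \<in> V" for x using bij that by (auto simp: bij_betw_def)
  have main: "({f x, z}, x) \<in> star_edges V f A B \<longleftrightarrow> ({f' (\<phi> x), \<phi> z}, \<phi> x) \<in> star_edges V' f' A' B'"
    if x: "x \<in> V" "z \<in> V" "z \<noteq> x" "z \<noteq> f x" for x z
  proof -
    have cl: "f x \<in> V" "f (f x) \<in> V" "f z \<in> V" using F.closed x by auto
    have "\<phi> z \<noteq> f' (\<phi> x)" "\<phi> z = f' (f' (\<phi> x)) \<longleftrightarrow> z = f (f x)" "f' (\<phi> z) = \<phi> x \<longleftrightarrow> f z = x"
      "f' (\<phi> z) = f' (\<phi> x) \<longleftrightarrow> f z = f x"
      unfolding f[symmetric, OF x(1)] f[symmetric, OF x(2)] f[symmetric, OF cl(1)]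
      using inj x cl by auto
    moreover have "\<phi> z \<noteq> \<phi> x" using inj x by simp
    ultimately show ?thesis
      using A[OF x(1)] A[OF x(2)] B[OF x(1,2)] x(3)
      unfolding F.star_edges_iff[OF x] F'.star_edges_iff[OF V'[OF x(1)] V'[OF x(2)] \<open>\<phi> z \<noteq> \<phi> x\<close> \<open>\<phi> z \<noteq> f' (\<phi> x)\<close>]
      by auto
  qed
  have "(T, h) \<in> star_edges V f A B \<longleftrightarrow> (\<phi> ` T, \<phi> h) \<in> star_edges V' f' A' B'"
    if T: "T \<subseteq> V" "h \<in> V" for T h
  proof
    assume "(T, h) \<in> star_edges V f A B"
    then obtain z where z: "T = {f h, z}" "z \<in> V" "z \<noteq> h" "z \<noteq> f h" by (rule F.star_edgesE) blast
    then show "(\<phi> ` T, \<phi> h) \<in> star_edges V' f' A' B'"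
      using main[OF T(2) z(2-4)] \<open>(T, h) \<in> star_edges V f A B\<close> f[OF T(2)] by simp
  next
    assume e: "(\<phi> ` T, \<phi> h) \<in> star_edges V' f' A' B'"
    then obtain y where y: "\<phi> ` T = {f' (\<phi> h), y}" "y \<in> V'" "y \<noteq> \<phi> h" "y \<noteq> f' (\<phi> h)"
      by (rule F'.star_edgesE) blast
    then obtain z where z: "z \<in> V" "y = \<phi> z" using bij by (auto simp: bij_betw_def)
    have "\<phi> ` T = \<phi> ` {f h, z}" using y z f[OF T(2)] by simp
    then have Tz: "T = {f h, z}"
      using inj_on_image_eq_iff[of \<phi> V T "{f h, z}"] bij T z F.closed by (auto simp: bij_betw_def)
    have "z \<noteq> h" "z \<noteq> f h" using y z f[OF T(2)] by auto
    then show "(T, h) \<in> star_edges V f A B"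
      using main[OF T(2) z(1)] e Tz f[OF T(2)] by simp
  qed
  then show ?thesis unfolding hiso_def using bij by auto
qed

context star_frame begin

text \<open>On a three-cycle the slot \<open>(x, f (f x))\<close> also requires
  \<open>f (f x) \<notin> A\<close>, which \<open>A_cycle\<close> supplies.\<close>

lemma A_iff: "x \<in> V \<Longrightarrow> x \<in> A \<longleftrightarrow> ({f x, f (f x)}, x) \<in> star_edges V f A B"
proof -
  assume x: "x \<in> V"
  have "f (f (f x)) = x \<Longrightarrow> x \<in> A \<Longrightarrow> f (f x) \<notin> A"
    using A_cycle[of "f (f x)"] closed x by auto
  moreover have "f (f (f x)) \<noteq> f x" using no_2cycle[OF closed[OF x]] .
  ultimately show ?thesis
    using star_edges_iff[of x "f (f x)"] x closed no_2cycle no_fix[OF closed[OF x]] by auto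
qed

lemma B_iff:
  assumes "x \<in> V" "y \<in> V" "x \<noteq> y" "f x = f y"
  shows "(x, y) \<in> B \<longleftrightarrow> ({f x, y}, x) \<in> star_edges V f A B"
proof -
  have "y \<noteq> f x" using assms no_fix[of y] by metis
  moreover have "y \<noteq> f (f x)" using assms no_2cycle[of "f x"] closed by metis
  moreover have "f y \<noteq> x" using assms no_fix[of x] by metis
  ultimately show ?thesis using star_edges_iff[of x y] assms by auto
qed

end

text \<open>Once \<open>f\<close> is recovered from the edges, \<open>A_iff\<close> and
  \<open>B_iff\<close> recover \<open>A\<close> and \<open>B\<close>. Richness of the source is
  enough, as its edges are carried to the target.\<close>

lemma hiso_star_edgesD:
  assumes F: "star_frame V f A B" and F': "star_frame V' f' A' B'"
    and rich: "\<And>x. x \<in> V \<Longrightarrow> \<exists>y z. y \<noteq> z \<and> y \<in> V \<and> z \<in> V \<and>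
      ({f x, y}, x) \<in> star_edges V f A B \<and> ({f x, z}, x) \<in> star_edges V f A B"
    and iso: "hiso (HGraph V (star_edges V f A B)) (HGraph V' (star_edges V' f' A' B'))"
  obtains \<phi> where "bij_betw \<phi> V V'" "\<And>x. x \<in> V \<Longrightarrow> \<phi> (f x) = f' (\<phi> x)"
    "\<And>x. x \<in> V \<Longrightarrow> x \<in> A \<longleftrightarrow> \<phi> x \<in> A'"
    "\<And>x y. x \<in> V \<Longrightarrow> y \<in> V \<Longrightarrow> x \<noteq> y \<Longrightarrow> f x = f y \<Longrightarrow> (x, y) \<in> B \<longleftrightarrow> (\<phi> x, \<phi> y) \<in> B'"
proof -
  interpret F: star_frame V f A B by (rule F)
  interpret F': star_frame V' f' A' B' by (rule F')
  obtain \<phi> where bij: "bij_betw \<phi> V V'"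
    and e: "\<And>T h. T \<subseteq> V \<Longrightarrow> h \<in> V \<Longrightarrow> (T, h) \<in> star_edges V f A B \<longleftrightarrow> (\<phi> ` T, \<phi> h) \<in> star_edges V' f' A' B'"
    using iso unfolding hiso_def by auto
  have inj: "\<phi> x = \<phi> y \<longleftrightarrow> x = y" if "x \<in> V" "y \<in> V" for x y
    using bij that by (auto simp: bij_betw_def inj_on_def)
  have V': "\<phi> x \<in> V'" if "x \<in> V" for x using bij that by (auto simp: bij_betw_def)
  \<comment> \<open>\<open>f x\<close> is recovered as the common vertex of two tails at \<open>x\<close>.\<close>
  have f: "\<phi> (f x) = f' (\<phi> x)" if x: "x \<in> V" for x
  proof -
    obtain y z where yz: "y \<noteq> z" "y \<in> V" "z \<in> V" "({f x, y}, x) \<in> star_edges V f A B"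
      "({f x, z}, x) \<in> star_edges V f A B" using rich[OF x] by blast
    have "(\<phi> ` {f x, y}, \<phi> x) \<in> star_edges V' f' A' B'" "(\<phi> ` {f x, z}, \<phi> x) \<in> star_edges V' f' A' B'"
      using e[of "{f x, y}" x] e[of "{f x, z}" x] yz x F.closed by auto
    then have "f' (\<phi> x) \<in> \<phi> ` {f x, y}" "f' (\<phi> x) \<in> \<phi> ` {f x, z}"
      by (auto elim!: F'.star_edgesE)
    then show ?thesis using inj[OF yz(2,3)] yz(1) by auto
  qed
  have "x \<in> A \<longleftrightarrow> \<phi> x \<in> A'" if x: "x \<in> V" for x
    using F.A_iff[OF x] F'.A_iff[OF V'[OF x]] e[of "{f x, f (f x)}" x] x F.closed f by simp
  moreover have "(x, y) \<in> B \<longleftrightarrow> (\<phi> x, \<phi> y) \<in> B'" if x: "x \<in> V" "y \<in> V" "x \<noteq> y" "f x = f y" for x y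
  proof -
    have "f' (\<phi> x) = f' (\<phi> y)" using f x by metis
    then show ?thesis
      using F.B_iff[OF x] F'.B_iff[of "\<phi> x" "\<phi> y"] V' inj e[of "{f x, y}" x] f x F.closed by simp
  qed
  ultimately show thesis using that[OF bij f] by blast
qed

section \<open>Normal forms\<close>

text \<open>
  The normal forms: the core is \<open>0 \<rightarrow> 1 \<rightarrow> \<dots> \<rightarrow> s - 1 \<rightarrow> j\<close>, and the vertices from \<open>s\<close> on form three-cycles of
  consecutive numbers whose first vertex is the head. The set \<open>rho_B\<close> matters only for \<open>j > 0\<close>.
\<close>

definition rho :: "nat \<Rightarrow> nat \<Rightarrow> nat \<Rightarrow> nat" where
  "rho s j x = (if x < s then if Suc x = s then j else Suc x
     else if (x - s) mod 3 = 2 then x - 2 else Suc x)"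

definition rho_A :: "nat \<Rightarrow> bool list \<Rightarrow> nat set" where
  "rho_A s xs = {x. if x < s then xs ! x else (x - s) mod 3 = 0}"

definition rho_B :: "nat \<Rightarrow> nat \<Rightarrow> bool \<Rightarrow> (nat \<times> nat) set" where
  "rho_B s j b = (if b then {(j - 1, s - 1)} else {(s - 1, j - 1)})"

definition rho_graph :: "nat \<Rightarrow> nat \<Rightarrow> nat \<Rightarrow> bool list \<Rightarrow> bool \<Rightarrow> nat pre_hgraph" where
  "rho_graph n s j xs b = HGraph {..<n} (star_edges {..<n} (rho s j) (rho_A s xs) (rho_B s j b))"

lemma ge_cases:
  assumes "(s::nat) \<le> x"
  obtains i m where "x = s + 3 * i + m" "m \<in> {0, 1, 2}"
proof
  show "x = s + 3 * ((x - s) div 3) + (x - s) mod 3" using assms by simp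
  show "(x - s) mod 3 \<in> {0, 1, 2}" by auto
qed

lemma rho_simps:
  "rho s j (s + 3 * i) = s + 3 * i + 1"
  "rho s j (s + 3 * i + 1) = s + 3 * i + 2"
  "rho s j (s + 3 * i + 2) = s + 3 * i"
  unfolding rho_def by (simp_all add: mod_Suc)

lemma rho_A_simps:
  "s + 3 * i \<in> rho_A s xs" "s + 3 * i + 1 \<notin> rho_A s xs" "s + 3 * i + 2 \<notin> rho_A s xs"
  unfolding rho_A_def by (simp_all add: mod_Suc)

lemma rho_ge: "s \<le> x \<Longrightarrow> s \<le> rho s j x \<and> rho s j (rho s j (rho s j x)) = x"
  by (erule ge_cases) (auto simp: rho_simps simp del: add_2_eq_Suc' One_nat_def)

lemma rho_less: "j < s \<Longrightarrow> x < s \<Longrightarrow> rho s j x < s"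
  unfolding rho_def by auto

text \<open>Beyond the core the map permutes, and inside it only the closing step from
  \<open>s - 1\<close> to \<open>j\<close> can repeat a value. Hence a single bit describes
  \<open>B\<close>.\<close>

lemma rho_collision:
  assumes "j < s" "rho s j x = rho s j y" "x \<noteq> y"
  shows "j > 0 \<and> (x = j - 1 \<and> y = s - 1 \<or> x = s - 1 \<and> y = j - 1)"
proof -
  have "x < s \<and> y < s"
  proof (rule ccontr)
    assume "\<not> (x < s \<and> y < s)"
    then have "s \<le> x \<and> s \<le> y" using rho_less[OF assms(1)] rho_ge[of s] assms(2) by (metis not_le)
    then show False using rho_ge[of s] assms(2,3) by metis
  qed
  then show ?thesis using assms unfolding rho_def by (auto split: if_splits)
qed

text \<open>A cycle on more than three vertices carries arbitrary labels, whereas a three-cycle in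
  the core must have exactly one head. The case \<open>s = 3\<close> falls under the second
  alternative with \<open>j = 0\<close>.\<close>

definition rho_ok :: "nat \<Rightarrow> nat \<Rightarrow> nat \<Rightarrow> bool list \<Rightarrow> bool" where
  "rho_ok n s j xs \<longleftrightarrow> n \<ge> 9 \<and> s = 3 + n mod 3 \<and> length xs = s \<and>
    (s > 3 \<and> j = 0 \<or> j = s - 3 \<and> length (filter (\<lambda>x. x) (drop j xs)) = 1)"

lemma list_lengths:
  "length xs = 3 \<longleftrightarrow> (\<exists>a b c. xs = [a, b, c])"
  "length xs = 4 \<longleftrightarrow> (\<exists>a b c d. xs = [a, b, c, d])"
  "length xs = 5 \<longleftrightarrow> (\<exists>a b c d e. xs = [a, b, c, d, e])"
  by (auto simp: numeral_eq_Suc length_Suc_conv)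

lemma rho_ok_cases:
  assumes "rho_ok n s j xs"
  obtains a b c where "s = 3" "j = 0" "xs = [a, b, c]" "length (filter (\<lambda>x. x) xs) = 1"
  | a b c d where "s = 4" "j = 0" "xs = [a, b, c, d]"
  | a b c d e where "s = 5" "j = 0" "xs = [a, b, c, d, e]"
  | a b c d where "s = 4" "j = 1" "xs = [a, b, c, d]" "length (filter (\<lambda>x. x) [b, c, d]) = 1"
  | a b c d e where "s = 5" "j = 2" "xs = [a, b, c, d, e]" "length (filter (\<lambda>x. x) [c, d, e]) = 1"
proof -
  have "s = 3 \<or> s = 4 \<or> s = 5" using assms unfolding rho_ok_def by auto
  then show thesis using assms that unfolding rho_ok_def
    by (elim disjE) (auto simp: list_lengths)
qed

lemma rho_core:
  assumes "rho_ok n s j xs" "x < s"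
  shows "rho s j x \<noteq> x" "rho s j (rho s j x) \<noteq> x"
    "rho s j (rho s j (rho s j x)) = x \<longleftrightarrow> s - 3 = j \<and> j \<le> x"
    "rho s j (rho s j (rho s j x)) = x \<Longrightarrow> x \<in> rho_A s xs \<Longrightarrow> rho s j x \<notin> rho_A s xs"
proof -
  have "rho s j x \<noteq> x \<and> rho s j (rho s j x) \<noteq> x \<and>
    (rho s j (rho s j (rho s j x)) = x \<longleftrightarrow> s - 3 = j \<and> j \<le> x) \<and>
    (rho s j (rho s j (rho s j x)) = x \<longrightarrow> x \<in> rho_A s xs \<longrightarrow> rho s j x \<notin> rho_A s xs)"
    using assms(1)
  proof (cases rule: rho_ok_cases)
    case (1 a b c)
    then consider "x = 0" | "x = 1" | "x = 2" using assms(2) by linarith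
    then show ?thesis using 1 by cases (auto simp: rho_def rho_A_def split: if_splits)
  next
    case (2 a b c d)
    then consider "x = 0" | "x = 1" | "x = 2" | "x = 3" using assms(2) by linarith
    then show ?thesis using 2 by cases (auto simp: rho_def rho_A_def)
  next
    case (3 a b c d e)
    then consider "x = 0" | "x = 1" | "x = 2" | "x = 3" | "x = 4" using assms(2) by linarith
    then show ?thesis using 3 by cases (auto simp: rho_def rho_A_def)
  next
    case (4 a b c d)
    then consider "x = 0" | "x = 1" | "x = 2" | "x = 3" using assms(2) by linarith
    then show ?thesis using 4 by cases (auto simp: rho_def rho_A_def split: if_splits)
  next
    case (5 a b c d e)
    then consider "x = 0" | "x = 1" | "x = 2" | "x = 3" | "x = 4" using assms(2) by linarith
    then show ?thesis using 5 by cases (auto simp: rho_def rho_A_def split: if_splits)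
  qed
  then show "rho s j x \<noteq> x" "rho s j (rho s j x) \<noteq> x"
    "rho s j (rho s j (rho s j x)) = x \<longleftrightarrow> s - 3 = j \<and> j \<le> x"
    "rho s j (rho s j (rho s j x)) = x \<Longrightarrow> x \<in> rho_A s xs \<Longrightarrow> rho s j x \<notin> rho_A s xs"
    by auto
qed

lemma rho_ok_bounds: "rho_ok n s j xs \<Longrightarrow> s \<le> n \<and> j < s \<and> n = s + 3 * (n div 3 - 1) \<and> s \<le> 5 \<and> 3 \<le> s"
proof -
  assume ok: "rho_ok n s j xs"
  have "3 + n mod 3 + 3 * (n div 3 - 1) = n" if "n \<ge> 9" using that by presburger
  then show ?thesis using ok unfolding rho_ok_def by auto
qed

lemma rho_lt_n:
  assumes ok: "rho_ok n s j xs" and x: "x < n"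
  shows "rho s j x < n"
proof (cases "x < s")
  case True
  then show ?thesis using rho_less[of j s x] rho_ok_bounds[OF ok] by simp
next
  case False
  then obtain i m where "x = s + 3 * i + m" "m \<in> {0, 1, 2}" by (meson ge_cases not_le)
  moreover obtain q where "n = s + 3 * q" using rho_ok_bounds[OF ok] by blast
  ultimately show ?thesis using x
    by (auto simp: rho_simps simp del: add_2_eq_Suc' One_nat_def) presburger+
qed

lemma star_frame_rho:
  assumes ok: "rho_ok n s j xs"
  shows "star_frame {..<n} (rho s j) (rho_A s xs) (rho_B s j b)"
proof
  fix x assume x: "x \<in> {..<n}"
  then show "rho s j x \<in> {..<n}" using rho_lt_n[OF ok] by simp
  have ge: "\<exists>i m. x = s + 3 * i + m \<and> m \<in> {0, 1, 2}" if "\<not> x < s" using that by (meson ge_cases not_le)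
  show "rho s j x \<noteq> x" "rho s j (rho s j x) \<noteq> x"
    using rho_core[OF ok] ge by (cases "x < s"; auto simp: rho_simps simp del: add_2_eq_Suc' One_nat_def)+
  show "rho s j x \<notin> rho_A s xs" if "rho s j (rho s j (rho s j x)) = x" "x \<in> rho_A s xs"
  proof (cases "x < s")
    case False
    then show ?thesis using ge that(2)
      by (auto simp: rho_simps rho_A_simps simp del: add_2_eq_Suc' One_nat_def)
  qed (use rho_core[OF ok] that in blast)
next
  fix x y assume "x \<noteq> y" "rho s j x = rho s j y" "(x, y) \<in> rho_B s j b"
  then show "(y, x) \<notin> rho_B s j b" unfolding rho_B_def by (auto split: if_splits)
qed auto

text \<open>The three-cycles beyond the core have \<open>n div 3 - 1\<close> heads. A three-cycle in
  the core adds one and allows one loss at its entry if \<open>j > 0\<close>; a longer cycle adds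
  neither.\<close>

lemma rho_many:
  assumes ok: "rho_ok n s j xs"
  shows "n div 3 + card (star_frame.losses {..<n} (rho s j) (rho_B s j b))
    \<le> card (star_frame.apex {..<n} (rho s j) (rho_A s xs)) + (if n mod 3 = 0 then 0 else 1)"
proof -
  interpret F: star_frame "{..<n}" "rho s j" "rho_A s xs" "rho_B s j b"
    by (rule star_frame_rho[OF ok])
  have bd: "s \<le> n" "j < s" "n = s + 3 * (n div 3 - 1)" using rho_ok_bounds[OF ok] by auto
  have k: "n div 3 \<ge> 3" using ok unfolding rho_ok_def by auto
  let ?far = "(\<lambda>i. s + 3 * i) ` {..<n div 3 - 1}"
  have far: "?far \<subseteq> F.apex"
  proof
    fix x assume "x \<in> ?far"
    then obtain i where i: "x = s + 3 * i" "i < n div 3 - 1" by auto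
    then have "x < n" using bd(3) by linarith
    then show "x \<in> F.apex" using i rho_A_simps(1)[of s i xs] rho_ge[of s x j]
      unfolding F.apex_def F.cyc3_def by auto
  qed
  have cfar: "card ?far = n div 3 - 1" by (simp add: card_image inj_on_def)
  have fina: "finite F.apex" unfolding F.apex_def F.cyc3_def by auto
  show ?thesis
  proof (cases "j = s - 3")
    case True
    have "\<exists>h<s. j \<le> h \<and> xs ! h"
    proof -
      have "length (filter (\<lambda>x. x) (drop j xs)) = 1" "length xs = s"
        using ok True unfolding rho_ok_def by auto
      then have "filter (\<lambda>x. x) (drop j xs) \<noteq> []" by auto
      then obtain x where "x \<in> set (drop j xs)" "x" by (auto simp: filter_empty_conv)
      then obtain i where "i < length xs - j" "drop j xs ! i" by (auto simp: in_set_conv_nth)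
      then show ?thesis using \<open>length xs = s\<close> bd(2) by (intro exI[of _ "j + i"]) auto
    qed
    then obtain h where h: "h < s" "j \<le> h" "xs ! h" by blast
    have "h \<in> rho_A s xs" using h unfolding rho_A_def by simp
    then have "h \<in> F.apex" using h rho_core(3)[OF ok h(1)] True bd(1)
      unfolding F.apex_def F.cyc3_def by auto
    then have "card (insert h ?far) \<le> card F.apex" using far fina by (intro card_mono) auto
    moreover have "h \<notin> ?far" using h(1) by auto
    ultimately have ap: "n div 3 \<le> card F.apex" using cfar k by simp
    show ?thesis
    proof (cases "j = 0")
      case True
      have "F.losses = {}" using rho_collision[OF bd(2)] True unfolding F.losses_def by blast
      then show ?thesis using ap by simp
    next
      case False
      then have "n mod 3 \<noteq> 0" using ok True unfolding rho_ok_def by auto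
      moreover have "F.losses \<subseteq> {if b then (s - 1, j - 1) else (j - 1, s - 1)}"
      proof
        fix p assume "p \<in> F.losses"
        then obtain x y where p: "p = (x, y)" "x \<noteq> y" "rho s j x = rho s j y" "(x, y) \<notin> rho_B s j b"
          unfolding F.losses_def by blast
        then show "p \<in> {if b then (s - 1, j - 1) else (j - 1, s - 1)}"
          using rho_collision[OF bd(2) p(3,2)] unfolding rho_B_def by (auto split: if_splits)
      qed
      then have "card F.losses \<le> 1" using card_mono[of "{if b then (s - 1, j - 1) else (j - 1, s - 1)}" F.losses] by simp
      ultimately show ?thesis using ap by simp
    qed
  next
    case False
    then have j: "j = 0" "s > 3" using ok unfolding rho_ok_def by auto
    then have "n mod 3 \<noteq> 0" using ok unfolding rho_ok_def by auto
    moreover have "F.losses = {}" using rho_collision[OF bd(2)] j unfolding F.losses_def by blast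
    moreover have "n div 3 - 1 \<le> card F.apex" using cfar card_mono[OF fina far] by simp
    ultimately show ?thesis by simp
  qed
qed

text \<open>The map preserves the core and its complement, so a slot joining the two sides lies on
  no contested triple.\<close>

lemma rho_edge:
  assumes ok: "rho_ok n s j xs" and x: "x < n" "z < n" "(x < s) \<noteq> (z < s)"
  shows "({rho s j x, z}, x) \<in> star_edges {..<n} (rho s j) (rho_A s xs) (rho_B s j b)"
proof -
  interpret F: star_frame "{..<n}" "rho s j" "rho_A s xs" "rho_B s j b"
    by (rule star_frame_rho[OF ok])
  have iff: "rho s j y < s \<longleftrightarrow> y < s" for y
    using rho_less[of j s y] rho_ge[of s y j] rho_ok_bounds[OF ok] by (metis not_le)
  have "z \<noteq> x" "z \<noteq> rho s j x" "z \<noteq> rho s j (rho s j x)" "rho s j z \<noteq> x" "rho s j z \<noteq> rho s j x"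
    using x(3) iff by metis+
  then show ?thesis using F.star_edges_iff[of x z] x by auto
qed

lemma hiso_rho_graphD:
  assumes ok: "rho_ok n s j xs" and ok': "rho_ok n s j' xs'"
    and iso: "hiso (rho_graph n s j xs b) (rho_graph n s j' xs' b')"
  obtains \<phi> where "bij_betw \<phi> {..<n} {..<n}" "\<And>x. x < n \<Longrightarrow> \<phi> (rho s j x) = rho s j' (\<phi> x)"
    "\<And>x. x < n \<Longrightarrow> x \<in> rho_A s xs \<longleftrightarrow> \<phi> x \<in> rho_A s xs'"
    "\<And>x y. x < n \<Longrightarrow> y < n \<Longrightarrow> x \<noteq> y \<Longrightarrow> rho s j x = rho s j y \<Longrightarrow>
      (x, y) \<in> rho_B s j b \<longleftrightarrow> (\<phi> x, \<phi> y) \<in> rho_B s j' b'"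
proof (rule hiso_star_edgesD[OF star_frame_rho[OF ok] star_frame_rho[OF ok'] _ iso[unfolded rho_graph_def]])
  fix x assume x: "x \<in> {..<n}"
  have bd: "s + 2 \<le> n" "3 \<le> s" using ok unfolding rho_ok_def by auto
  \<comment> \<open>Both sides of the core have at least two vertices, so the opposite side provides
    two tails.\<close>
  define y where "y = (if x < s then s else 0)"
  define z where "z = (if x < s then Suc s else 1)"
  have "y \<noteq> z" "y < n" "z < n" "(x < s) \<noteq> (y < s)" "(x < s) \<noteq> (z < s)"
    using bd by (auto simp: y_def z_def)
  then show "\<exists>y z. y \<noteq> z \<and> y \<in> {..<n} \<and> z \<in> {..<n} \<and>
      ({rho s j x, y}, x) \<in> star_edges {..<n} (rho s j) (rho_A s xs) (rho_B s j b) \<and>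
      ({rho s j x, z}, x) \<in> star_edges {..<n} (rho s j) (rho_A s xs) (rho_B s j b)"
    using rho_edge[OF ok, of x y] rho_edge[OF ok, of x z] x by (intro exI[of _ y] exI[of _ z]) auto
qed (use that in auto)

lemma rho_collision_eq: "0 < j \<Longrightarrow> j < s \<Longrightarrow> rho s j (j - 1) = rho s j (s - 1)"
  unfolding rho_def by auto

text \<open>For \<open>j > 0\<close> the map has a unique starting vertex, which anchors the whole
  core and leaves no freedom. For \<open>j = 0\<close> the core may rotate, so only cyclic
  invariants survive: the number of heads and of consecutive heads.\<close>

lemma rho_graph_index_unique:
  assumes ok: "rho_ok n s j xs" and ok': "rho_ok n s j' xs'"
    and iso: "hiso (rho_graph n s j xs b) (rho_graph n s j' xs' b')"
  shows "j = j'" "j > 0 \<Longrightarrow> xs = xs' \<and> b = b'"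
    "j = 0 \<Longrightarrow> s > 3 \<Longrightarrow> card {x. x < s \<and> xs ! x} = card {x. x < s \<and> xs' ! x} \<and>
      card {x. x < s \<and> xs ! x \<and> xs ! rho s 0 x} = card {x. x < s \<and> xs' ! x \<and> xs' ! rho s 0 x}"
proof -
  obtain \<phi> where bij: "bij_betw \<phi> {..<n} {..<n}"
    and f: "\<And>x. x < n \<Longrightarrow> \<phi> (rho s j x) = rho s j' (\<phi> x)"
    and A: "\<And>x. x < n \<Longrightarrow> x \<in> rho_A s xs \<longleftrightarrow> \<phi> x \<in> rho_A s xs'"
    and B: "\<And>x y. x < n \<Longrightarrow> y < n \<Longrightarrow> x \<noteq> y \<Longrightarrow> rho s j x = rho s j y \<Longrightarrow>
      (x, y) \<in> rho_B s j b \<longleftrightarrow> (\<phi> x, \<phi> y) \<in> rho_B s j' b'"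
    using hiso_rho_graphD[OF assms] by blast
  have bd: "s \<le> n" "j < s" "j' < s" "length xs = s" "length xs' = s" "0 < n" "3 \<le> s" "s \<le> 5"
    using ok ok' rho_ok_bounds[OF ok] unfolding rho_ok_def by auto
  have inj: "\<phi> x = \<phi> y \<longleftrightarrow> x = y" if "x < n" "y < n" for x y
    using bij that by (auto simp: bij_betw_def inj_on_def)
  have lt: "\<phi> x < n" if "x < n" for x using bij that by (auto simp: bij_betw_def)
  have surj: "\<exists>x<n. y = \<phi> x" if "y < n" for y using bij that by (auto simp: bij_betw_def image_iff)
  \<comment> \<open>Collisions occur exactly for a positive index, and isomorphisms transport
    them.\<close>
  have zero: "j = 0 \<longleftrightarrow> j' = 0"
  proof
    assume j: "j = 0"
    show "j' = 0"
    proof (rule ccontr)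
      assume j': "j' \<noteq> 0"
      have "j' - 1 < n" "s - 1 < n" using bd by linarith+
      then obtain x y where x: "x < n" "j' - 1 = \<phi> x" and y: "y < n" "s - 1 = \<phi> y"
        using surj by meson
      have "\<phi> (rho s j x) = \<phi> (rho s j y)"
        using rho_collision_eq[of j' s] j' bd f x y by simp
      then have "rho s j x = rho s j y" using inj rho_lt_n[OF ok] x(1) y(1) by blast
      moreover have "x \<noteq> y" using x y j' bd by auto
      ultimately show False using rho_collision[OF bd(2)] j by blast
    qed
  next
    assume j': "j' = 0"
    show "j = 0"
    proof (rule ccontr)
      assume j: "j \<noteq> 0"
      have l: "j - 1 < n" "s - 1 < n" "j - 1 \<noteq> s - 1" using bd j by auto
      have "rho s j' (\<phi> (j - 1)) = rho s j' (\<phi> (s - 1))"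
        using f[OF l(1)] f[OF l(2)] rho_collision_eq[of j s] j bd by simp
      moreover have "\<phi> (j - 1) \<noteq> \<phi> (s - 1)" using inj l by blast
      ultimately show False using rho_collision[OF bd(3)] j' by blast
    qed
  qed
  show jj: "j = j'" using zero ok ok' unfolding rho_ok_def by auto
  show "xs = xs' \<and> b = b'" if j: "j > 0"
  proof -
    have ne0: "rho s j x \<noteq> 0" for x
      using j rho_ge[of s x j] bd(7) by (cases "x < s") (auto simp: rho_def)
    have im: "\<exists>x<n. y = rho s j x" if "y \<noteq> 0" "y < n" for y
    proof (cases "y < s")
      case True
      then show ?thesis using that by (intro exI[of _ "y - 1"]) (auto simp: rho_def)
    next
      case False
      then show ?thesis using rho_ge[of s y j] rho_lt_n[OF ok] that
        by (intro exI[of _ "rho s j (rho s j y)"]) auto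
    qed
    \<comment> \<open>0 is the only vertex outside the range of \<open>rho s j\<close>.\<close>
    have "\<phi> 0 = 0"
    proof (rule ccontr)
      assume "\<phi> 0 \<noteq> 0"
      then obtain u where "u < n" "\<phi> 0 = rho s j u" using im lt[OF bd(6)] by blast
      then obtain x where x: "x < n" "u = \<phi> x" using surj by blast
      then have "\<phi> 0 = \<phi> (rho s j x)" using f jj \<open>\<phi> 0 = rho s j u\<close> by simp
      then show False using inj[OF bd(6) rho_lt_n[OF ok x(1)]] ne0[of x] by simp
    qed
    have id: "i < s \<Longrightarrow> \<phi> i = i" for i
    proof (induction i)
      case (Suc i)
      then have "rho s j i = Suc i" unfolding rho_def by auto
      then show ?case using f[of i] Suc bd(1) jj by auto
    qed (use \<open>\<phi> 0 = 0\<close> in simp)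
    have "xs ! i = xs' ! i" if "i < s" for i
      using A[of i] that id[OF that] bd(1) unfolding rho_A_def by auto
    then have "xs = xs'" using bd by (intro nth_equalityI) auto
    moreover have "b = b'"
    proof -
      have l: "j - 1 < n" "s - 1 < n" "j - 1 \<noteq> s - 1" "j - 1 < s" "s - 1 < s" using bd j by auto
      have "(j - 1, s - 1) \<in> rho_B s j b \<longleftrightarrow> (j - 1, s - 1) \<in> rho_B s j b'"
        using B[OF l(1-3) rho_collision_eq[OF j bd(2)]] by (simp only: id[OF l(4)] id[OF l(5)] jj[symmetric])
      then show ?thesis using l(3) unfolding rho_B_def by (auto split: if_splits)
    qed
    ultimately show ?thesis by simp
  qed
  show "card {x. x < s \<and> xs ! x} = card {x. x < s \<and> xs' ! x} \<and>
      card {x. x < s \<and> xs ! x \<and> xs ! rho s 0 x} = card {x. x < s \<and> xs' ! x \<and> xs' ! rho s 0 x}"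
    if j: "j = 0" and s: "s > 3"
  proof -
    \<comment> \<open>The core consists of the vertices not on three-cycles, a description that the
      isomorphism preserves.\<close>
    have c3: "x < s \<longleftrightarrow> rho s 0 (rho s 0 (rho s 0 x)) \<noteq> x" for x
      using rho_core(3)[OF ok, of x] rho_ge[of s x 0] s j by (cases "x < s") auto
    have core: "\<phi> x < s \<longleftrightarrow> x < s" if x: "x < n" for x
    proof -
      have l: "rho s 0 x < n" "rho s 0 (rho s 0 x) < n" "rho s 0 (rho s 0 (rho s 0 x)) < n"
        using rho_lt_n[OF ok] x j by auto
      have "rho s 0 (rho s 0 (rho s 0 (\<phi> x))) = \<phi> (rho s 0 (rho s 0 (rho s 0 x)))"
        using f x l j jj by simp
      then show ?thesis using c3[of x] c3[of "\<phi> x"] inj[OF l(3) x] by simp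
    qed
    have img: "\<phi> ` {..<s} = {..<s}"
    proof (rule card_subset_eq)
      show "\<phi> ` {..<s} \<subseteq> {..<s}" using core bd(1) by auto
      have "inj_on \<phi> {..<s}" using bij bd(1) by (auto simp: bij_betw_def inj_on_def)
      then show "card (\<phi> ` {..<s}) = card {..<s}" by (rule card_image)
    qed simp
    have xs: "xs ! x \<longleftrightarrow> xs' ! \<phi> x" if "x < s" for x
      using A[of x] core[of x] that bd(1) unfolding rho_A_def by auto
    have rl: "rho s 0 x < s" if "x < s" for x using rho_less[of 0 s x] that s by simp
    have injs: "inj_on \<phi> {x. x < s \<and> P x}" for P
      using bij bd(1) by (auto simp: bij_betw_def inj_on_def)
    have card: "card {x. x < s \<and> P x} = card {x. x < s \<and> Q x}"
      if "\<And>x. x < s \<Longrightarrow> P x \<longleftrightarrow> Q (\<phi> x)" for P Q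
    proof -
      have "{x. x < s \<and> Q x} = \<phi> ` {x. x < s \<and> P x}"
      proof (intro set_eqI iffI)
        fix y assume y: "y \<in> {x. x < s \<and> Q x}"
        then have "y \<in> \<phi> ` {..<s}" unfolding img by simp
        then show "y \<in> \<phi> ` {x. x < s \<and> P x}" using that y by auto
      qed (use that img in auto)
      then show ?thesis using card_image[OF injs] by simp
    qed
    have "rho s 0 (\<phi> x) = \<phi> (rho s 0 x)" if "x < s" for x using f[of x] that bd(1) j jj by simp
    then show ?thesis using card[of "\<lambda>x. xs ! x" "\<lambda>x. xs' ! x"] xs rl
        card[of "\<lambda>x. xs ! x \<and> xs ! rho s 0 x" "\<lambda>x. xs' ! x \<and> xs' ! rho s 0 x"] by auto
  qed
qed

section \<open>Reduction of an arbitrary core to a normal form\<close>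

context star_frame begin

lemma core_image_closed:
  assumes "core c s j" "j < s" "x \<in> c ` {..<s}"
  shows "f x \<in> c ` {..<s}"
  using assms unfolding core_def by (auto split: if_splits)

text \<open>Outside the core \<open>f\<close> has order three with one apex per orbit, so numbering
  these \<open>k\<close> apexes and applying \<open>f\<close> extends \<open>c\<close> to all
  vertices. The two clauses on \<open>b\<close> say that exactly one slot of the collision is in
  use.\<close>

lemma hiso_rho_graph:
  assumes core: "core c s j" and xs: "\<And>i. i < s \<Longrightarrow> xs ! i \<longleftrightarrow> c i \<in> A"
    and ok: "rho_ok (card V) s j xs"
    and B: "j > 0 \<Longrightarrow> (b \<longleftrightarrow> (c (j - 1), c (s - 1)) \<in> B) \<and> (b \<longleftrightarrow> (c (s - 1), c (j - 1)) \<notin> B)"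
  shows "hiso (rho_graph (card V) s j xs b) (HGraph V (star_edges V f A B))"
proof -
  define n where "n = card V"
  define k where "k = n div 3 - 1"
  have bd: "s \<le> n" "j < s" "n = s + 3 * k" using rho_ok_bounds[OF ok] unfolding n_def k_def by auto
  have c: "inj_on c {..<s}" "c ` {..<s} \<subseteq> V" "\<And>i. i < s \<Longrightarrow> f (c i) = c (if Suc i = s then j else Suc i)"
    "V - c ` {..<s} \<subseteq> triangles"
    using core unfolding core_def by auto
  define W where "W = V - c ` {..<s}"
  have W_tri: "f (f (f x)) = x" if "x \<in> W" for x using c(4) triangles_cyc3 that unfolding W_def by auto
  \<comment> \<open>The core is closed under \<open>f\<close>, so an orbit of length three that
    entered it would never get back out to \<open>x\<close>.\<close>
  have fW: "f x \<in> W" if x: "x \<in> W" for x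
  proof -
    have "f x \<notin> c ` {..<s}"
    proof
      assume "f x \<in> c ` {..<s}"
      then have "f (f (f x)) \<in> c ` {..<s}" using core_image_closed[OF core bd(2)] by blast
      then show False using W_tri[OF x] x unfolding W_def by simp
    qed
    then show ?thesis using x closed unfolding W_def by auto
  qed
  define P where "P = apex \<inter> W"
  have W_eq: "x \<in> P \<or> f x \<in> P \<or> f (f x) \<in> P" if x: "x \<in> W" for x
  proof -
    have "x \<in> triangles" using x c(4) unfolding W_def by auto
    then consider "x \<in> apex" | "f x \<in> apex" | "f (f x) \<in> apex"
      unfolding triangles_def using apexD by fastforce
    then show ?thesis using fW x unfolding P_def by cases auto
  qed
  have finP: "finite P" unfolding P_def W_def using fin by auto
  have "card P = k"
  proof -
    have W3: "W = P \<union> f ` P \<union> f ` f ` P"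
    proof
      show "W \<subseteq> P \<union> f ` P \<union> f ` f ` P"
      proof
        fix x assume x: "x \<in> W"
        have "x = f (f (f x))" using W_tri[OF x] by simp
        then show "x \<in> P \<union> f ` P \<union> f ` f ` P" using W_eq[OF x] by blast
      qed
      show "P \<union> f ` P \<union> f ` f ` P \<subseteq> W" using fW unfolding P_def by auto
    qed
    have PW: "P \<subseteq> W" "f ` P \<subseteq> W" unfolding W3 by auto
    have "f ` P \<inter> A = {}" "f ` f ` P \<inter> A = {}" "P \<subseteq> A"
      using apex_next apexD unfolding P_def by auto
    moreover have inj: "inj_on f W" using W_tri by (metis inj_onI)
    moreover have "inj_on f P" "inj_on f (f ` P)" using inj_on_subset[OF inj] W3 by blast+
    moreover have "f ` P \<inter> f ` f ` P = {}"
    proof -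
      have "f ` P \<inter> f ` f ` P = f ` (P \<inter> f ` P)"
        using inj_on_image_Int[OF inj, of P "f ` P"] PW by simp
      then show ?thesis using calculation(1,3) by auto
    qed
    ultimately have "card W = card P + card P + card P"
      using finP unfolding W3 by (subst card_Un_disjoint, simp, simp, blast, subst card_Un_disjoint) (auto simp: card_image)
    moreover have "card W = n - s"
      unfolding W_def n_def using c(1,2) fin by (simp add: card_Diff_subset card_image)
    ultimately show ?thesis using bd by simp
  qed
  then obtain p where p: "bij_betw p {..<k} P" using ex_bij_betw_nat_finite[OF finP] by (auto simp: atLeast0LessThan)
  define \<phi> where "\<phi> x = (if x < s then c x else (f ^^ ((x - s) mod 3)) (p ((x - s) div 3)))" for x
  have \<phi>_core: "\<phi> x = c x" if "x < s" for x using that by (simp add: \<phi>_def)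
  have \<phi>_far: "\<phi> (s + 3 * i) = p i" "\<phi> (s + 3 * i + 1) = f (p i)" "\<phi> (s + 3 * i + 2) = f (f (p i))" for i
  proof -
    have "(3 * i + 1) div 3 = i" "(3 * i + 2) div 3 = i" "(3 * i + 1) mod 3 = 1" "(3 * i + 2) mod 3 = 2"
      by presburger+
    then show "\<phi> (s + 3 * i) = p i" "\<phi> (s + 3 * i + 1) = f (p i)" "\<phi> (s + 3 * i + 2) = f (f (p i))"
      unfolding \<phi>_def by (simp_all add: numeral_2_eq_2)
  qed
  have far: "\<exists>i<k. x = s + 3 * i \<or> x = s + 3 * i + 1 \<or> x = s + 3 * i + 2"
    if x: "x < n" "\<not> x < s" for x
  proof -
    obtain i m where im: "x = s + 3 * i + m" "m \<in> {0, 1, 2}" using x(2) by (meson ge_cases not_le)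
    then have "i < k" using x(1) bd(3) by linarith
    then show ?thesis using im by auto
  qed
  have pP: "p i \<in> apex \<and> p i \<in> W" if "i < k" for i using p that unfolding bij_betw_def P_def by auto
  have img: "\<phi> ` {..<n} = V"
  proof
    show "\<phi> ` {..<n} \<subseteq> V"
    proof (rule image_subsetI)
      fix x assume x: "x \<in> {..<n}"
      show "\<phi> x \<in> V"
      proof (cases "x < s")
        case True
        then show ?thesis using \<phi>_core c(2) by auto
      next
        case False
        then obtain i where i: "i < k" "x = s + 3 * i \<or> x = s + 3 * i + 1 \<or> x = s + 3 * i + 2"
          using far x by auto
        have "p i \<in> V" using pP[OF i(1)] apexD by blast
        then show ?thesis using i(2) \<phi>_far[of i] closed by metis
      qed
    qed
    show "V \<subseteq> \<phi> ` {..<n}"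
    proof
      fix x assume x: "x \<in> V"
      show "x \<in> \<phi> ` {..<n}"
      proof (cases "x \<in> W")
        case False
        then obtain i where "i < s" "x = c i" using x unfolding W_def by auto
        then show ?thesis using \<phi>_core[of i] bd(1) by (intro image_eqI[of _ _ i]) auto
      next
        case True
        have *: "y \<in> \<phi> ` {..<n} \<and> f y \<in> \<phi> ` {..<n} \<and> f (f y) \<in> \<phi> ` {..<n}" if "y \<in> P" for y
        proof -
          have "y \<in> p ` {..<k}" using p \<open>y \<in> P\<close> by (simp add: bij_betw_def)
          then obtain i where i: "i < k" "y = p i" by (elim imageE) simp
          then have "s + 3 * i + 2 < n" using bd(3) by linarith
          moreover have "\<phi> z \<in> \<phi> ` {..<n}" if "z < n" for z using that by (intro imageI) simp
          ultimately have "\<phi> (s + 3 * i) \<in> \<phi> ` {..<n}" "\<phi> (s + 3 * i + 1) \<in> \<phi> ` {..<n}"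
            "\<phi> (s + 3 * i + 2) \<in> \<phi> ` {..<n}" by simp_all
          then show ?thesis unfolding i(2) \<phi>_far by (intro conjI)
        qed
        consider "x \<in> P" | "f x \<in> P" | "f (f x) \<in> P" using W_eq[OF True] by blast
        then show ?thesis
        proof cases
          case 2
          then have "f (f (f x)) \<in> \<phi> ` {..<n}" using * by blast
          then show ?thesis unfolding W_tri[OF True] .
        next
          case 3
          then have "f (f (f x)) \<in> \<phi> ` {..<n}" using * by blast
          then show ?thesis unfolding W_tri[OF True] .
        qed (use * in blast)
      qed
    qed
  qed
  \<comment> \<open>Both sides have \<open>n\<close> elements, so surjectivity suffices.\<close>
  have bij: "bij_betw \<phi> {..<n} V"
    unfolding bij_betw_def using img eq_card_imp_inj_on[of "{..<n}" \<phi>] by (simp add: n_def)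
  have okn: "rho_ok n s j xs" using ok unfolding n_def .
  show ?thesis unfolding rho_graph_def n_def[symmetric]
  proof (rule hiso_star_edgesI[OF star_frame_rho[OF okn] star_frame_axioms bij])
    fix x assume x: "x \<in> {..<n}"
    show "\<phi> (rho s j x) = f (\<phi> x)"
    proof (cases "x < s")
      case True
      then show ?thesis using \<phi>_core c(3) bd(2) by (auto simp: rho_def)
    next
      case False
      then obtain i where i: "i < k" "x = s + 3 * i \<or> x = s + 3 * i + 1 \<or> x = s + 3 * i + 2"
        using far x by auto
      then show ?thesis using \<phi>_far[of i] rho_simps[of s j i] pP[OF i(1)] apexD by metis
    qed
    show "x \<in> rho_A s xs \<longleftrightarrow> \<phi> x \<in> A"
    proof (cases "x < s")
      case True
      then show ?thesis using \<phi>_core xs by (auto simp: rho_A_def)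
    next
      case False
      then obtain i where i: "i < k" "x = s + 3 * i \<or> x = s + 3 * i + 1 \<or> x = s + 3 * i + 2"
        using far x by auto
      then show ?thesis
        using \<phi>_far[of i] rho_A_simps[of s i xs] pP[OF i(1)] apexD apex_next by metis
    qed
  next
    fix x y assume xy: "x \<in> {..<n}" "y \<in> {..<n}" "x \<noteq> y" "rho s j x = rho s j y"
    have j: "j > 0" and "x = j - 1 \<and> y = s - 1 \<or> x = s - 1 \<and> y = j - 1"
      using rho_collision[OF bd(2) xy(4,3)] by auto
    moreover have "\<phi> (j - 1) = c (j - 1)" "\<phi> (s - 1) = c (s - 1)" using bd(2) by (auto intro!: \<phi>_core)
    moreover have "j - 1 \<noteq> s - 1" using j bd(2) by simp
    ultimately show "(x, y) \<in> rho_B s j b \<longleftrightarrow> (\<phi> x, \<phi> y) \<in> B"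
      using B[OF j] unfolding rho_B_def by auto
  qed
qed

lemma core_rotate1:
  assumes core: "core c s 0" and s: "s > 0"
  shows "core (\<lambda>i. f (c i)) s 0"
proof -
  have c: "inj_on c {..<s}" "c ` {..<s} \<subseteq> V" "\<And>i. i < s \<Longrightarrow> f (c i) = c (if Suc i = s then 0 else Suc i)"
    "V - c ` {..<s} \<subseteq> triangles" "s - 3 = 0 \<longrightarrow> c 0 \<in> triangles"
    using core unfolding core_def by auto
  have img: "(\<lambda>i. f (c i)) ` {..<s} = c ` {..<s}"
  proof
    show "(\<lambda>i. f (c i)) ` {..<s} \<subseteq> c ` {..<s}" using c(3) s by auto
    show "c ` {..<s} \<subseteq> (\<lambda>i. f (c i)) ` {..<s}"
    proof
      fix y assume "y \<in> c ` {..<s}"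
      then obtain i where i: "i \<in> {..<s}" and y: "y = c i" by blast
      show "y \<in> (\<lambda>i. f (c i)) ` {..<s}"
      proof (cases i)
        case 0
        then show ?thesis unfolding y using c(3)[of "s - 1"] s by (intro image_eqI[of _ _ "s - 1"]) auto
      next
        case (Suc i')
        then show ?thesis unfolding y using c(3)[of i'] i by (intro image_eqI[of _ _ i']) auto
      qed
    qed
  qed
  have "inj_on (\<lambda>i. f (c i)) {..<s}"
    by (rule eq_card_imp_inj_on) (simp_all add: img card_image[OF c(1)])
  moreover have "f (f (c i)) = f (c (if Suc i = s then 0 else Suc i))" if "i < s" for i
    using c(3)[OF that] by simp
  ultimately show ?thesis
    unfolding core_def img using c(2,4,5) triangles_closed by auto
qed

text \<open>Composing \<open>c\<close> with \<open>f\<close> shifts the starting point of the cycle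
  by one and rotates the word of labels with it.\<close>

lemma core_rotate:
  assumes core: "core c s 0" and s: "s > 0"
  shows "\<exists>c'. core c' s 0 \<and> map (\<lambda>i. c' i \<in> A) [0..<s] = rotate d (map (\<lambda>i. c i \<in> A) [0..<s])"
proof (induction d)
  case 0
  then show ?case using core by auto
next
  case (Suc d)
  then obtain c' where c': "core c' s 0" "map (\<lambda>i. c' i \<in> A) [0..<s] = rotate d (map (\<lambda>i. c i \<in> A) [0..<s])"
    by blast
  have "map (\<lambda>i. f (c' i) \<in> A) [0..<s] = rotate1 (map (\<lambda>i. c' i \<in> A) [0..<s])"
  proof (rule nth_equalityI)
    fix i assume "i < length (map (\<lambda>i. f (c' i) \<in> A) [0..<s])"
    then have i: "i < s" by simp
    then have "f (c' i) = c' (Suc i mod s)"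
      using c'(1) unfolding core_def by (auto simp: mod_Suc)
    then show "map (\<lambda>i. f (c' i) \<in> A) [0..<s] ! i = rotate1 (map (\<lambda>i. c' i \<in> A) [0..<s]) ! i"
      using i s by (simp add: nth_rotate1)
  qed simp
  then show ?case using core_rotate1[OF c'(1) s] c'(2) by (intro exI[of _ "\<lambda>i. f (c' i)"]) simp
qed

end

section \<open>Counting the indices\<close>

text \<open>One representative of each rotation class of binary words. For \<open>s = 3\<close> only
  words with exactly one \<open>True\<close> are admissible, which form a single class.\<close>

definition necklaces :: "nat \<Rightarrow> bool list list" where
  "necklaces s = (if s = 3 then [[True, False, False]]
    else if s = 4 then [[False, False, False, False], [True, False, False, False], [True, True, False, False],
      [True, False, True, False], [True, True, True, False], [True, True, True, True]]
    else [[False, False, False, False, False], [True, False, False, False, False],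
      [True, True, False, False, False], [True, False, True, False, False],
      [True, True, True, False, False], [True, True, False, True, False],
      [True, True, True, True, False], [True, True, True, True, True]])"

lemma ex_necklace:
  assumes "length xs = s" "s = 3 \<and> length (filter (\<lambda>x. x) xs) = 1 \<or> s = 4 \<or> s = 5"
  shows "\<exists>d. rotate d xs \<in> set (necklaces s)"
proof -
  have r: "rotate 0 xs = xs" "rotate 1 xs = rotate1 xs" "rotate 2 xs = rotate1 (rotate1 xs)"
    "rotate 3 xs = rotate1 (rotate1 (rotate1 xs))" "rotate 4 xs = rotate1 (rotate1 (rotate1 (rotate1 xs)))"
    by (simp_all add: numeral_eq_Suc)
  have "\<exists>d\<in>{0, 1, 2, 3, 4}. rotate d xs \<in> set (necklaces s)"
    unfolding bex_simps r using assms(2)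
  proof (elim disjE conjE)
    assume "s = 3" "length (filter (\<lambda>x. x) xs) = 1"
    moreover then obtain a b c where "xs = [a, b, c]" using assms(1) by (auto simp: list_lengths)
    ultimately show "xs \<in> set (necklaces s) \<or> rotate1 xs \<in> set (necklaces s) \<or>
      rotate1 (rotate1 xs) \<in> set (necklaces s) \<or> rotate1 (rotate1 (rotate1 xs)) \<in> set (necklaces s) \<or>
      rotate1 (rotate1 (rotate1 (rotate1 xs))) \<in> set (necklaces s) \<or> False"
      by (cases a; cases b; cases c) (simp_all add: necklaces_def)
  next
    assume "s = 4"
    moreover then obtain a b c d where "xs = [a, b, c, d]" using assms(1) by (auto simp: list_lengths)
    ultimately show "xs \<in> set (necklaces s) \<or> rotate1 xs \<in> set (necklaces s) \<or>
      rotate1 (rotate1 xs) \<in> set (necklaces s) \<or> rotate1 (rotate1 (rotate1 xs)) \<in> set (necklaces s) \<or>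
      rotate1 (rotate1 (rotate1 (rotate1 xs))) \<in> set (necklaces s) \<or> False"
      by (cases a; cases b; cases c; cases d) (simp_all add: necklaces_def)
  next
    assume "s = 5"
    moreover then obtain a b c d e where "xs = [a, b, c, d, e]" using assms(1) by (auto simp: list_lengths)
    ultimately show "xs \<in> set (necklaces s) \<or> rotate1 xs \<in> set (necklaces s) \<or>
      rotate1 (rotate1 xs) \<in> set (necklaces s) \<or> rotate1 (rotate1 (rotate1 xs)) \<in> set (necklaces s) \<or>
      rotate1 (rotate1 (rotate1 (rotate1 xs))) \<in> set (necklaces s) \<or> False"
      by (cases a; cases b; cases c; cases d; cases e) (simp_all add: necklaces_def)
  qed
  then show ?thesis by blast
qed

text \<open>At these lengths the number of ones and the number of cyclically adjacent ones separate
  the classes.\<close>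

lemma necklaces_distinguished:
  assumes "s = 4 \<or> s = 5" and "xs \<in> set (necklaces s)" "ys \<in> set (necklaces s)"
    and "card {x. x < s \<and> xs ! x} = card {x. x < s \<and> ys ! x}"
    and "card {x. x < s \<and> xs ! x \<and> xs ! rho s 0 x} = card {x. x < s \<and> ys ! x \<and> ys ! rho s 0 x}"
  shows "xs = ys"
proof -
  \<comment> \<open>As lengths of filtered lists the cardinalities can be evaluated.\<close>
  have card: "card {x. x < s \<and> P x} = length (filter P [0..<s])" for P
    using distinct_card[of "filter P [0..<s]"] by (simp add: set_filter)
  have all: "\<forall>s\<in>{4, 5}. \<forall>xs\<in>set (necklaces s). \<forall>ys\<in>set (necklaces s).
    length (filter (\<lambda>x. xs ! x) [0..<s]) = length (filter (\<lambda>x. ys ! x) [0..<s]) \<longrightarrow>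
    length (filter (\<lambda>x. xs ! x \<and> xs ! rho s 0 x) [0..<s]) = length (filter (\<lambda>x. ys ! x \<and> ys ! rho s 0 x) [0..<s]) \<longrightarrow>
    xs = ys"
    by code_simp
  show ?thesis using all assms unfolding card by blast
qed

lemma necklaces_ok:
  assumes "s = 3 \<or> s = 4 \<or> s = 5" "xs \<in> set (necklaces s)"
  shows "length xs = s" "s = 3 \<Longrightarrow> length (filter (\<lambda>x. x) xs) = 1"
  using assms unfolding necklaces_def by auto

text \<open>The labels of a path running into a three-cycle: the last three positions are the cycle
  and hold its one head. Filtering the list of all words makes the size computable.\<close>

definition marked :: "nat \<Rightarrow> bool list set" where
  "marked s = set (filter (\<lambda>xs. length (filter (\<lambda>x. x) (drop (s - 3) xs)) = 1) (List.n_lists s [True, False]))"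

lemma marked_iff: "xs \<in> marked s \<longleftrightarrow> length xs = s \<and> length (filter (\<lambda>x. x) (drop (s - 3) xs)) = 1"
  unfolding marked_def by (auto simp: set_n_lists)

lemma card_marked: "card (marked 4) = 6" "card (marked 5) = 12"
proof -
  have "card (marked s) = length (filter (\<lambda>xs. length (filter (\<lambda>x. x) (drop (s - 3) xs)) = 1) (List.n_lists s [True, False]))" for s
    unfolding marked_def by (intro distinct_card distinct_filter distinct_n_lists) simp
  moreover have "length (filter (\<lambda>xs. length (filter (\<lambda>x. x) (drop (4 - 3) xs)) = 1) (List.n_lists 4 [True, False])) = 6"
    "length (filter (\<lambda>xs. length (filter (\<lambda>x. x) (drop (5 - 3) xs)) = 1) (List.n_lists 5 [True, False])) = 12"
    by code_simp+
  ultimately show "card (marked 4) = 6" "card (marked 5) = 12" by simp_all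
qed

text \<open>On a cycle there is no collision to decide, so the third component is pinned to
  \<open>True\<close> to avoid counting graphs twice.\<close>

definition indices :: "nat \<Rightarrow> (nat \<times> bool list \<times> bool) set" where
  "indices s = {0} \<times> set (necklaces s) \<times> {True} \<union> (if s > 3 then {s - 3} \<times> marked s \<times> UNIV else {})"

lemma card_indices: "card (indices 3) = 1" "card (indices 4) = 18" "card (indices 5) = 32"
proof -
  have fin: "finite (marked s)" for s unfolding marked_def by simp
  have n: "card (set (necklaces 3)) = 1" "card (set (necklaces 4)) = 6" "card (set (necklaces 5)) = 8"
    unfolding necklaces_def by simp_all
  show "card (indices 3) = 1" unfolding indices_def by (simp add: card_cartesian_product n)
  have U: "card (UNIV :: bool set) = 2" by simp
  show "card (indices 4) = 18" "card (indices 5) = 32"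
    unfolding indices_def using fin
    by (simp_all add: card_Un_disjoint card_cartesian_product n card_marked U disjoint_iff)
qed

lemma indices_ok:
  assumes "n \<ge> 9" "s = 3 + n mod 3" "(j, xs, b) \<in> indices s"
  shows "rho_ok n s j xs"
proof -
  have s: "s = 3 \<or> s = 4 \<or> s = 5" using assms(2) by linarith
  show ?thesis using assms necklaces_ok[OF s, of xs] s unfolding indices_def rho_ok_def
    by (auto simp: marked_iff split: if_splits)
qed

section \<open>Extremal number and isomorphism classes\<close>

lemma num_iso_classes_eq:
  assumes "\<And>i. i \<in> I \<Longrightarrow> K i \<in> X"
    and "\<And>G. G \<in> X \<Longrightarrow> \<exists>i\<in>I. hiso (K i) G"
    and "\<And>i j. i \<in> I \<Longrightarrow> j \<in> I \<Longrightarrow> hiso (K i) (K j) \<Longrightarrow> i = j"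
  shows "num_iso_classes X = card I"
proof -
  let ?r = "{(G, H). G \<in> X \<and> H \<in> X \<and> hiso G H}"
  have eq: "equiv X ?r" by (rule equiv_hiso)
  have "bij_betw (\<lambda>i. ?r `` {K i}) I (X // ?r)"
    unfolding bij_betw_def
  proof
    show "inj_on (\<lambda>i. ?r `` {K i}) I"
    proof (rule inj_onI)
      fix i j assume ij: "i \<in> I" "j \<in> I" "?r `` {K i} = ?r `` {K j}"
      then have "(K i, K j) \<in> ?r" using eq_equiv_class[OF ij(3) eq] assms(1) by simp
      then show "i = j" using assms(3) ij by simp
    qed
    show "(\<lambda>i. ?r `` {K i}) ` I = X // ?r"
    proof
      show "(\<lambda>i. ?r `` {K i}) ` I \<subseteq> X // ?r" using assms(1) by (intro image_subsetI quotientI)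
      show "X // ?r \<subseteq> (\<lambda>i. ?r `` {K i}) ` I"
      proof
        fix C assume "C \<in> X // ?r"
        then obtain G where G: "G \<in> X" "C = ?r `` {G}" by (rule quotientE)
        obtain i where i: "i \<in> I" "hiso (K i) G" using assms(2)[OF G(1)] by blast
        then have "?r `` {K i} = ?r `` {G}"
          using equiv_class_eq[OF eq, of "K i" G] assms(1) G(1) by simp
        then show "C \<in> (\<lambda>i. ?r `` {K i}) ` I" using G(2) i(1) by blast
      qed
    qed
  qed
  then show ?thesis unfolding num_iso_classes_def by (rule bij_betw_same_card[symmetric])
qed

abbreviation excess :: "nat \<Rightarrow> nat" where
  "excess n \<equiv> (if n mod 3 = 0 then 0 else 1)"

lemma free_oriented_iff: "G \<in> free_oriented n I0 \<longleftrightarrow> free_hgraph G \<and> card (verts G) = n"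
  unfolding free_oriented_def free_hgraph_def by auto

lemma (in star_frame) star_edges_upper:
  "card (star_edges V f A B) + card V + excess (card V) \<le> card V * (card V - 2) + card V div 3"
  using card_star_edges card_apex_le unfolding apex_def by linarith

text \<open>A defect costs 2, more than \<open>excess n\<close>; otherwise the graph lies inside a
  graph built from \<open>f\<close>. Adding on the left avoids truncated subtraction in the case of
  equality.\<close>

lemma edges_upper:
  assumes "n \<ge> 9" "G \<in> free_oriented n I0"
  shows "card (edges G) + n + excess n \<le> n * (n - 2) + n div 3"
proof -
  interpret G: free_hgraph G using assms(2) by (simp add: free_oriented_iff)
  have n: "card (verts G) = n" using assms(2) by (simp add: free_oriented_iff)
  consider "card (edges G) + n + 2 \<le> n * (n - 2) + n div 3"
    | f A B where "star_frame (verts G) f A B" "edges G \<subseteq> star_edges (verts G) f A B"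
    using G.star_frame_or_few_edges assms(1) unfolding n by blast
  then show ?thesis
  proof cases
    case 1
    then show ?thesis by simp
  next
    case 2
    interpret F: star_frame "verts G" f A B by (rule 2(1))
    have "finite (star_edges (verts G) f A B)"
      using free_hgraph.finE[of F.H] F.hgraph F.oriented F.hfree unfolding free_hgraph_def by simp
    then have "card (edges G) \<le> card (star_edges (verts G) f A B)" using 2(2) by (rule card_mono)
    then show ?thesis using F.star_edges_upper unfolding n by linarith
  qed
qed

lemma rho_graph_extremal:
  assumes ok: "rho_ok n s j xs"
  shows "rho_graph n s j xs b \<in> free_oriented n I0"
    and "card (edges (rho_graph n s j xs b)) + n + excess n = n * (n - 2) + n div 3"
proof -
  interpret F: star_frame "{..<n}" "rho s j" "rho_A s xs" "rho_B s j b"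
    by (rule star_frame_rho[OF ok])
  have n: "n \<ge> 9" using ok unfolding rho_ok_def by simp
  show mem: "rho_graph n s j xs b \<in> free_oriented n I0"
    using F.hgraph F.oriented F.hfree unfolding rho_graph_def free_oriented_def by simp
  have "n * (n - 2) + n div 3 \<le> card (edges (rho_graph n s j xs b)) + n + excess n"
    using F.card_star_edges rho_many[OF ok, of b] unfolding rho_graph_def F.apex_def pre_hgraph.sel card_lessThan
    by linarith
  then show "card (edges (rho_graph n s j xs b)) + n + excess n = n * (n - 2) + n div 3"
    using edges_upper[OF n mem] by linarith
qed

lemma hiso_rho_graph_if_extremal:
  assumes n: "n \<ge> 9" and G: "G \<in> free_oriented n I0"
    and card: "card (edges G) + n + excess n = n * (n - 2) + n div 3"
  shows "\<exists>(j, xs, b)\<in>indices (3 + n mod 3). hiso (rho_graph n (3 + n mod 3) j xs b) G"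
proof -
  define s where "s = 3 + n mod 3"
  interpret G: free_hgraph G using G by (simp add: free_oriented_iff)
  have nV: "card (verts G) = n" using G by (simp add: free_oriented_iff)
  \<comment> \<open>Missing the bound by 2 contradicts \<open>card\<close>, which leaves the
    alternative without defects.\<close>
  have "excess n \<le> 1" by simp
  then obtain f A B where fab: "star_frame (verts G) f A B" "edges G \<subseteq> star_edges (verts G) f A B"
    using G.star_frame_or_few_edges n card unfolding nV by fastforce
  interpret F: star_frame "verts G" f A B by (rule fab(1))
  have "finite (star_edges (verts G) f A B)"
    using free_hgraph.finE[of F.H] F.hgraph F.oriented F.hfree unfolding free_hgraph_def by simp
  moreover have "card (star_edges (verts G) f A B) \<le> card (edges G)"
    using F.star_edges_upper card unfolding nV by linarith
  ultimately have eq: "edges G = star_edges (verts G) f A B"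
    using fab(2) card_seteq by blast
  then have G_eq: "G = F.H" by (cases G) simp
  \<comment> \<open>Equality in the edge count turns \<open>card_star_edges\<close> into the reverse
    of \<open>card_apex_le\<close>.\<close>
  have "card (verts G) div 3 + card F.losses \<le> card F.apex + excess (card (verts G))"
    using F.card_star_edges card unfolding eq[symmetric] nV F.apex_def[symmetric] by linarith
  moreover have "verts G \<noteq> {}" using n nV by auto
  ultimately obtain c where c: "F.core c s 0 \<or> s > 3 \<and> F.core c s (s - 3) \<and>
    ((c (s - 4), c (s - 1)) \<in> B \<longleftrightarrow> (c (s - 1), c (s - 4)) \<notin> B)"
    using F.core_exists[of s] unfolding nV s_def by blast
  have s: "s = 3 \<or> s = 4 \<or> s = 5" "0 < s" unfolding s_def by linarith+
  have marks: "length (filter (\<lambda>x. x) (drop (s - 3) (map (\<lambda>i. c i \<in> A) [0..<s]))) = 1"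
    if core: "F.core c s (s - 3)" for c
  proof -
    define j where "j = s - 3"
    have sj: "s = Suc (Suc (Suc j))" using s by (auto simp: j_def)
    have cc: "f (c i) = c (if Suc i = s then j else Suc i)" if "i < s" for i
      using core that unfolding F.core_def j_def by blast
    have t: "c j \<in> F.triangles" using core unfolding F.core_def j_def by blast
    have "f (c j) = c (Suc j)" "f (f (c j)) = c (Suc (Suc j))"
      using cc[of j] cc[of "Suc j"] by (simp_all add: sj)
    then have one: "c j \<in> A \<and> c (Suc j) \<notin> A \<and> c (Suc (Suc j)) \<notin> A \<or>
      c j \<notin> A \<and> c (Suc j) \<in> A \<and> c (Suc (Suc j)) \<notin> A \<or>
      c j \<notin> A \<and> c (Suc j) \<notin> A \<and> c (Suc (Suc j)) \<in> A"
      using F.triangles_one_apex[OF t] by simp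
    have "drop j (map (\<lambda>i. c i \<in> A) [0..<s]) = map (\<lambda>i. c i \<in> A) [j, Suc j, Suc (Suc j)]"
      unfolding drop_map drop_upt sj by (simp add: upt_rec)
    then show ?thesis using one unfolding j_def by auto
  qed
  show ?thesis unfolding s_def[symmetric]
  proof (cases "F.core c s 0")
    case True
    let ?xs = "map (\<lambda>i. c i \<in> A) [0..<s]"
    \<comment> \<open>For \<open>s = 3\<close> the core is itself a three-cycle, and
      \<open>marks\<close> yields the single \<open>True\<close> that \<open>ex_necklace\<close>
      asks for.\<close>
    have "\<exists>d. rotate d ?xs \<in> set (necklaces s)"
      using ex_necklace[of ?xs s] s marks[of c] True by auto
    then obtain d where d: "rotate d ?xs \<in> set (necklaces s)" by blast
    obtain c' where c': "F.core c' s 0" "map (\<lambda>i. c' i \<in> A) [0..<s] = rotate d ?xs"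
      using F.core_rotate[OF True s(2)] by blast
    have idx: "(0, rotate d ?xs, True) \<in> indices s" using d unfolding indices_def by simp
    have "hiso (rho_graph n s 0 (rotate d ?xs) True) F.H"
      unfolding nV[symmetric]
    proof (rule F.hiso_rho_graph[OF c'(1)])
      show "rho_ok (card (verts G)) s 0 (rotate d ?xs)" using indices_ok[OF n s_def idx] unfolding nV .
      show "rotate d ?xs ! i \<longleftrightarrow> c' i \<in> A" if "i < s" for i unfolding c'(2)[symmetric] using that by simp
    qed simp
    then show "\<exists>(j, xs, b)\<in>indices s. hiso (rho_graph n s j xs b) G"
      unfolding G_eq[symmetric] using idx by blast
  next
    case False
    then have c: "s > 3" "F.core c s (s - 3)" "(c (s - 4), c (s - 1)) \<in> B \<longleftrightarrow> (c (s - 1), c (s - 4)) \<notin> B"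
      using c by auto
    let ?xs = "map (\<lambda>i. c i \<in> A) [0..<s]"
    let ?b = "(c (s - 4), c (s - 1)) \<in> B"
    have idx: "(s - 3, ?xs, ?b) \<in> indices s"
      using c(1) marks[OF c(2)] unfolding indices_def by (simp add: marked_iff)
    have "hiso (rho_graph n s (s - 3) ?xs ?b) F.H"
      unfolding nV[symmetric]
    proof (rule F.hiso_rho_graph[OF c(2)])
      show "rho_ok (card (verts G)) s (s - 3) ?xs" using indices_ok[OF n s_def idx] unfolding nV .
      have "s - 3 - 1 = s - 4" by simp
      then show "(?b \<longleftrightarrow> (c (s - 3 - 1), c (s - 1)) \<in> B) \<and> (?b \<longleftrightarrow> (c (s - 1), c (s - 3 - 1)) \<notin> B)"
        using c(3) by simp
    qed simp
    then show "\<exists>(j, xs, b)\<in>indices s. hiso (rho_graph n s j xs b) G"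
      unfolding G_eq[symmetric] using idx by blast
  qed
qed

lemma indices_unique:
  assumes n: "n \<ge> 9" and s: "s = 3 + n mod 3"
    and i: "(j, xs, b) \<in> indices s" "(j', xs', b') \<in> indices s"
    and iso: "hiso (rho_graph n s j xs b) (rho_graph n s j' xs' b')"
  shows "(j, xs, b) = (j', xs', b')"
proof -
  note u = rho_graph_index_unique[OF indices_ok[OF n s i(1)] indices_ok[OF n s i(2)] iso]
  show ?thesis
  proof (cases "j = 0")
    case False
    then show ?thesis using u(1,2) by simp
  next
    case True
    then have j: "j = 0" "j' = 0" using u(1) by auto
    then have neck: "xs \<in> set (necklaces s)" "xs' \<in> set (necklaces s)" "b = True" "b' = True"
      using i unfolding indices_def by (auto split: if_splits)
    have "xs = xs'"
    proof (cases "s = 3")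
      case True
      then show ?thesis using neck unfolding necklaces_def by simp
    next
      case False
      then have "s = 4 \<or> s = 5" "s > 3" using s by linarith+
      then show ?thesis using necklaces_distinguished[of s xs xs'] neck u(3)[OF j(1)] by blast
    qed
    then show ?thesis using j neck by simp
  qed
qed

lemma ex_o_and_classes:
  assumes n: "n \<ge> 9"
  shows "ex_o n I0 + n + excess n = n * (n - 2) + n div 3"
    and "num_iso_classes (extremal n I0) = card (indices (3 + n mod 3))"
proof -
  define s where "s = 3 + n mod 3"
  define K where "K = (\<lambda>(j, xs, b). rho_graph n s j xs b)"
  have K: "K i \<in> free_oriented n I0" "card (edges (K i)) + n + excess n = n * (n - 2) + n div 3"
    if "i \<in> indices s" for i
  proof -
    obtain j xs b where i: "i = (j, xs, b)" by (cases i)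
    then have "rho_ok n s j xs" using indices_ok[OF n s_def] that by blast
    then show "K i \<in> free_oriented n I0" "card (edges (K i)) + n + excess n = n * (n - 2) + n div 3"
      unfolding K_def i case_prod_conv by (rule rho_graph_extremal)+
  qed
  have "necklaces s \<noteq> []" unfolding necklaces_def by simp
  then have "(0, hd (necklaces s), True) \<in> indices s" unfolding indices_def by simp
  then obtain i where i: "i \<in> indices s" by blast
  have ex: "ex_o n I0 = card (edges (K i))"
    unfolding ex_o_def
  proof (rule Max_eqI)
    have "card (edges G) \<le> n * (n - 2) + n div 3" if "G \<in> free_oriented n I0" for G
      using edges_upper[OF n that] by linarith
    then have "{card (edges H) |H. H \<in> free_oriented n I0} \<subseteq> {..n * (n - 2) + n div 3}" by auto
    then show "finite {card (edges H) |H. H \<in> free_oriented n I0}"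
      by (rule finite_subset) simp
    show "y \<le> card (edges (K i))" if y: "y \<in> {card (edges H) |H. H \<in> free_oriented n I0}" for y
    proof -
      obtain G where "y = card (edges G)" "G \<in> free_oriented n I0" using y by blast
      then show ?thesis using edges_upper[OF n, of G] K(2)[OF i] by linarith
    qed
    show "card (edges (K i)) \<in> {card (edges H) |H. H \<in> free_oriented n I0}" using K(1)[OF i] by blast
  qed
  then show ex_eq: "ex_o n I0 + n + excess n = n * (n - 2) + n div 3" using K(2)[OF i] by simp
  show "num_iso_classes (extremal n I0) = card (indices (3 + n mod 3))"
    unfolding s_def[symmetric]
  proof (rule num_iso_classes_eq)
    show "K i \<in> extremal n I0" if "i \<in> indices s" for i
      using K[OF that] ex_eq unfolding extremal_def by simp
    show "\<exists>i\<in>indices s. hiso (K i) G" if "G \<in> extremal n I0" for G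
    proof -
      have "G \<in> free_oriented n I0" "card (edges G) + n + excess n = n * (n - 2) + n div 3"
        using that ex_eq unfolding extremal_def by auto
      then obtain i where "i \<in> indices s" "case i of (j, xs, b) \<Rightarrow> hiso (rho_graph n s j xs b) G"
        using hiso_rho_graph_if_extremal[OF n] unfolding s_def[symmetric] by blast
      then show ?thesis unfolding K_def by (intro bexI[of _ i]) (simp add: case_prod_beta)
    qed
    show "i = j" if "i \<in> indices s" "j \<in> indices s" "hiso (K i) (K j)" for i j
    proof -
      obtain k xs b k' xs' b' where ij: "i = (k, xs, b)" "j = (k', xs', b')" by (cases i, cases j)
      show ?thesis using that unfolding ij K_def case_prod_conv by (rule indices_unique[OF n s_def])
    qed
  qed
qed

theorem theorem2p1:
  fixes n :: nat
  assumes "n \<ge> 9"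
  shows "(n mod 3 = 0 \<longrightarrow>
           real (ex_o n I0) = real n * (real n - 3) + real n / 3 \<and>
           num_iso_classes (extremal n I0) = 1) \<and>
         (n mod 3 = 1 \<longrightarrow>
           real (ex_o n I0) = real n * (real n - 3) + (real n - 4) / 3 \<and>
           num_iso_classes (extremal n I0) = 18) \<and>
         (n mod 3 = 2 \<longrightarrow>
           real (ex_o n I0) = real n * (real n - 3) + (real n - 5) / 3 \<and>
           num_iso_classes (extremal n I0) = 32)"
proof -
  have "real (ex_o n I0 + n + excess n) = real (n * (n - 2) + n div 3)"
    using ex_o_and_classes(1)[OF assms] by simp
  then have ex: "real (ex_o n I0) = real n * (real n - 3) + real (n div 3) - real (excess n)"
  proof -
    define m where "m = n - 2"
    have m: "n = m + 2" using assms by (simp add: m_def)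
    have "real (n * (n - 2)) = real n * (real n - 2)" unfolding m by (simp add: algebra_simps)
    then show ?thesis using \<open>real (ex_o n I0 + n + excess n) = real (n * (n - 2) + n div 3)\<close>
      unfolding of_nat_add by (simp add: right_diff_distrib)
  qed
  have "real n = 3 * real (n div 3) + real (n mod 3)"
    by (metis div_mult_mod_eq mult.commute of_nat_add of_nat_mult of_nat_numeral)
  \<comment> \<open>For remainders 1 and 2 the extra 1 to be subtracted turns
    \<open>(n - 1) / 3\<close> and \<open>(n - 2) / 3\<close> into \<open>(n - 4) / 3\<close> and
    \<open>(n - 5) / 3\<close>.\<close>
  then have d: "real (n div 3) = (real n - real (n mod 3)) / 3" by simp
  show ?thesis
    unfolding ex d ex_o_and_classes(2)[OF assms] using card_indices
    by (auto simp: field_simps)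
qed

end
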